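(* Let $q$ be an odd prime power and $h$ an odd positive integer. Every Zha--Kyureghyan--Wang presemifield $(\mathbb{F}_{q^{3h}},+,\star)$ of order $q^{3h}$, with multiplication $$x\star y=y^{q^n}x+yx^{q^n}-v\,(y^{q^{h+n}}x^{q^{2h}}+y^{q^{2h}}x^{q^{h+n}}),$$ has middle nucleus and center both of order $q$. Here $0<n<3h$, $\gcd(h,n)=1$, $v=u^{q^h-1}$ with $u$ a primitive element of $\mathbb{F}_{q^{3h}}$, and either $h+n\equiv0\pmod3$ or $q\equiv1\pmod3$.
   Context: A finite semifield $(S,+,\star)$ satisfies all axioms of a skewfield except possibly associativity of multiplication; a presemifield satisfies all axioms of a semifield except possibly existence of a multiplicative identity. The left, middle, right nucleus of a semifield are the sets of elements $a$ (resp. $b$, $c$) with $(a\star b)\star c=a\star(b\star c)$ for all choices of the other two elements; the center is the set of elements in all three nuclei commuting multiplicatively with every element. Presemifields $(S,+,\star)$, $(S',+,\star')$ of characteristic $p$ are isotopic if there are invertible $\mathbb{F}_p$-linear maps $g_1,g_2,g_3:S\to S'$ with $g_1(x)\star' g_2(y)=g_3(x\star y)$ for all $x,y$. Every presemifield is isotopic to a semifield, and the orders of nuclei and center are isotopy invariants of semifields; the orders of the nuclei and center of a presemifield are by definition those of any semifield isotopic to it. Under the stated conditions the multiplication is known to define a commutative presemifield (a Zha--Kyureghyan--Wang presemifield). *)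

theory Defs
  imports Complex_Main "HOL-Library.Cardinality" "HOL-Number_Theory.Number_Theory" "HOL-Number_Theory.Prime_Powers"
begin

text \<open>
  Finite (pre)semifields are given by a multiplication on a finite type carrying an abelian
  group structure. The skewfield axiom on inverses, which is not meaningful without
  associativity and an identity, is rendered as usual for finite (pre)semifields by the absence
  of zero divisors; the lemma after the definition shows that this is the same as unique
  solvability of the equations \<open>a \<star> x = b\<close> and \<open>x \<star> a = b\<close> for nonzero \<open>a\<close>.
\<close>

definition presemifield :: "('a::{ab_group_add,finite} \<Rightarrow> 'a \<Rightarrow> 'a) \<Rightarrow> bool" where
  "presemifield m \<longleftrightarrow>
     (\<exists>a::'a. a \<noteq> 0) \<and>
     (\<forall>x y z. m x (y + z) = m x y + m x z) \<and>
     (\<forall>x y z. m (x + y) z = m x z + m y z) \<and>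
     (\<forall>x y. m x y = 0 \<longrightarrow> x = 0 \<or> y = 0)"

lemma presemifield_iff_bij:
  fixes m :: "'a::{ab_group_add,finite} \<Rightarrow> 'a \<Rightarrow> 'a"
  shows "presemifield m \<longleftrightarrow>
     (\<exists>a::'a. a \<noteq> 0) \<and>
     (\<forall>x y z. m x (y + z) = m x y + m x z) \<and>
     (\<forall>x y z. m (x + y) z = m x z + m y z) \<and>
     (\<forall>a. a \<noteq> 0 \<longrightarrow> bij (\<lambda>x. m a x) \<and> bij (\<lambda>x. m x a))"
proof -
  have "(\<forall>x y. m x y = 0 \<longrightarrow> x = 0 \<or> y = 0) \<longleftrightarrow>
        (\<forall>a. a \<noteq> 0 \<longrightarrow> bij (\<lambda>x. m a x) \<and> bij (\<lambda>x. m x a))"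
    if l: "\<And>x y z. m x (y + z) = m x y + m x z"
      and r: "\<And>x y z. m (x + y) z = m x z + m y z"
  proof -
    have r0: "m 0 x = 0" for x
      using r[of 0 0 x] by simp
    have ld: "m x (y - z) = m x y - m x z" for x y z
      using l[of x "y - z" z] by (simp only: diff_add_cancel add_diff_cancel_right')
    have rd: "m (y - z) x = m y x - m z x" for x y z
      using r[of "y - z" z x] by (simp only: diff_add_cancel add_diff_cancel_right')
    show ?thesis
    proof (intro iffI allI impI)
      fix a assume nz: "\<forall>x y. m x y = 0 \<longrightarrow> x = 0 \<or> y = 0" and a: "a \<noteq> (0::'a)"
      have "inj (\<lambda>x. m a x)"
      proof (rule injI)
        fix x y assume "m a x = m a y"
        then have "m a (x - y) = 0" by (simp only: ld diff_self)
        with nz a have "x - y = 0" by blast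
        then show "x = y" by simp
      qed
      moreover have "inj (\<lambda>x. m x a)"
      proof (rule injI)
        fix x y assume "m x a = m y a"
        then have "m (x - y) a = 0" by (simp only: rd diff_self)
        with nz a have "x - y = 0" by blast
        then show "x = y" by simp
      qed
      ultimately show "bij (\<lambda>x. m a x) \<and> bij (\<lambda>x. m x a)"
        by (simp add: bij_def finite_UNIV_inj_surj)
    next
      fix x y
      assume b: "\<forall>a. a \<noteq> 0 \<longrightarrow> bij (\<lambda>x. m a x) \<and> bij (\<lambda>x. m x a)" and xy: "m x y = 0"
      show "x = 0 \<or> y = 0"
      proof (rule disjCI)
        assume "y \<noteq> 0"
        with b have "inj (\<lambda>x. m x y)" by (simp add: bij_def)
        moreover have "m x y = m 0 y" by (simp only: xy r0)
        ultimately show "x = 0" by (rule injD)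
      qed
    qed
  qed
  then show ?thesis
    unfolding presemifield_def by (intro conj_cong refl) simp
qed

definition semifield :: "('a::{ab_group_add,finite} \<Rightarrow> 'a \<Rightarrow> 'a) \<Rightarrow> bool" where
  "semifield m \<longleftrightarrow> presemifield m \<and> (\<exists>e. e \<noteq> 0 \<and> (\<forall>x. m e x = x \<and> m x e = x))"

definition left_nucleus :: "('a \<Rightarrow> 'a \<Rightarrow> 'a) \<Rightarrow> 'a set" where
  "left_nucleus m = {a. \<forall>b c. m (m a b) c = m a (m b c)}"

definition middle_nucleus :: "('a \<Rightarrow> 'a \<Rightarrow> 'a) \<Rightarrow> 'a set" where
  "middle_nucleus m = {b. \<forall>a c. m (m a b) c = m a (m b c)}"

definition right_nucleus :: "('a \<Rightarrow> 'a \<Rightarrow> 'a) \<Rightarrow> 'a set" where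
  "right_nucleus m = {c. \<forall>a b. m (m a b) c = m a (m b c)}"

definition semifield_center :: "('a \<Rightarrow> 'a \<Rightarrow> 'a) \<Rightarrow> 'a set" where
  "semifield_center m =
     {z \<in> left_nucleus m \<inter> middle_nucleus m \<inter> right_nucleus m. \<forall>x. m z x = m x z}"

text \<open>
  Scalar multiplication by elements of the prime field is repeated addition, so
  \<open>\<F>\<^sub>p\<close>-linear maps between (pre)semifields of characteristic \<open>p\<close> are precisely
  the additive ones. The bijections below also force equality of the characteristics.
\<close>

definition isotopic ::
  "('a::{ab_group_add,finite} \<Rightarrow> 'a \<Rightarrow> 'a) \<Rightarrow> ('b::{ab_group_add,finite} \<Rightarrow> 'b \<Rightarrow> 'b) \<Rightarrow> bool" where
  "isotopic m m' \<longleftrightarrow>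
     (\<exists>g1 g2 g3 :: 'a \<Rightarrow> 'b.
        Modules.additive g1 \<and> bij g1 \<and> Modules.additive g2 \<and> bij g2 \<and>
        Modules.additive g3 \<and> bij g3 \<and>
        (\<forall>x y. m' (g1 x) (g2 y) = g3 (m x y)))"

definition primitive_element :: "'a::{field,finite} \<Rightarrow> bool" where
  "primitive_element u \<longleftrightarrow> range (\<lambda>k::nat. u ^ k) = UNIV - {0}"

definition zkw_mult :: "nat \<Rightarrow> nat \<Rightarrow> nat \<Rightarrow> 'a::field \<Rightarrow> 'a \<Rightarrow> 'a \<Rightarrow> 'a" where
  "zkw_mult q h n v x y =
     y ^ (q ^ n) * x + y * x ^ (q ^ n)
     - v * (y ^ (q ^ (h + n)) * x ^ (q ^ (2 * h)) + y ^ (q ^ (2 * h)) * x ^ (q ^ (h + n)))"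

end

theory Submission
  imports Defs
begin

text \<open>
  Let \<open>F\<close> be the field with \<open>q ^ (3 * h)\<close> elements, \<open>K\<close> its subfield of order \<open>q ^ h\<close>, and
  \<open>\<phi> k\<close> the automorphism \<open>x \<mapsto> x ^ (q ^ k)\<close> of \<open>F\<close>. Since \<open>v = \<phi> h u / u\<close>, the product is
  \<open>x \<star> y = B x y - (\<phi> h u / u) * \<phi> h (B' x y)\<close> with \<open>B x y = x * \<phi> n y + y * \<phi> n x\<close> and
  \<open>B' x y = \<phi> h x * \<phi> n y + \<phi> h y * \<phi> n x\<close>.

  \<^bold>\<open>Absence of zero divisors.\<close> If \<open>x \<star> (x * z) = 0\<close> with \<open>x\<close> and \<open>z\<close> nonzero, then
  \<open>w = u * (x * \<phi> n x * \<phi> h x)\<close> satisfies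
  \<open>w * (z + \<phi> n z) = \<phi> h w * \<phi> h (\<phi> h z + \<phi> n z)\<close>. Taking norms from \<open>F\<close> to \<open>K\<close> removes \<open>w\<close>. What
  remains is the vanishing of a \<open>3 \<times> 3\<close> determinant, that is, a \<open>K\<close>-linear dependence between
  \<open>z * \<rho> z\<close>, \<open>\<rho> z - z\<close> and \<open>1\<close>, where \<open>\<rho> = \<phi> (h + n)\<close> (\<open>linear_relation\<close>). Outside degenerate
  cases \<open>\<rho>\<close> thus moves \<open>z\<close> by a Moebius transformation over \<open>K\<close>; a translate \<open>s\<close> of \<open>z\<close> by an
  element of \<open>K\<close> satisfies \<open>s * \<rho> s = \<epsilon> * s + \<delta>\<close> with \<open>\<epsilon>\<close> and \<open>\<delta>\<close> in \<open>K\<close>, and the relation for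
  \<open>w\<close> says that \<open>\<phi> h w\<close> is an element of \<open>K\<close> times \<open>s\<close> (\<open>coset_of_K\<close>).

  This contradicts a power residue symbol: there is an exponent \<open>E\<close> such that the \<open>E\<close>-th power
  is \<open>1\<close> for the nonzero elements of \<open>K\<close>, for all nonzero \<open>x * \<phi> n x * \<phi> h x\<close> and for all such
  \<open>s\<close>, but not for the primitive element \<open>u\<close> (\<open>residue_exponent\<close>). If \<open>3\<close> divides \<open>h + n\<close> the symbol
  is that of \<open>(q\<^sup>2 + q + 1)\<close>-th powers; otherwise \<open>q \<equiv> 1\<close> modulo \<open>3\<close>, and it is the
  cubic one. That it is trivial at \<open>s\<close> is the heart of the proof: the product of \<open>s\<close> along its \<open>\<rho>\<close>-orbit is governed by products of
  \<open>2 \<times> 2\<close> matrices over \<open>K\<close>. In the first case the norm of \<open>s\<close> to the field of order \<open>q ^ 3\<close> turns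
  out to lie in the field of order \<open>q\<close> (\<open>norm_fixed\<close>). In the second, the matrix belonging to
  \<open>\<rho> ^ h\<close> permutes the three conjugates of \<open>s\<close> over \<open>K\<close> cyclically, so its trace \<open>t\<close> and
  determinant \<open>d\<close> satisfy \<open>t\<^sup>2 = d\<close>, and the norm of \<open>s\<close> to the field of order \<open>q\<close> is the cube
  of \<open>- t\<close> (\<open>norm_cube\<close>).

  \<^bold>\<open>Nuclei.\<close> In a semifield, the elements of the middle nucleus correspond to the pairs of maps with
  \<open>S (f x) y = S x (g y)\<close>, and the elements of the center to the triples with
  \<open>S (f x) y = k (S x y) = S x (g y)\<close>. An isotopism carries such pairs and triples over, so they can
  be counted in the presemifield. Comparing coefficients of the linearly independent functions
  \<open>\<phi> i\<close> shows that \<open>f\<close> and \<open>g\<close> are multiplication by the same element of the field of order \<open>q\<close>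
  (\<open>adjoint_imp_subfield_scalar\<close>). The exponents \<open>0\<close>, \<open>n\<close>, \<open>h + n\<close>, \<open>2 * h\<close> behave generically
  unless \<open>n\<close> is \<open>h\<close> or \<open>2 * h\<close>, which forces \<open>h = 1\<close>. For \<open>n = 2\<close> the presemifield is then a
  commutative twisted field; for \<open>n = 1\<close> a further coefficient would give \<open>1 = - 8\<close> by taking
  norms, which \<open>q \<equiv> 1\<close> modulo \<open>3\<close> excludes.
\<close>

section \<open>Nuclei as isotopy invariants\<close>

abbreviation inv_fun :: "('a \<Rightarrow> 'b) \<Rightarrow> 'b \<Rightarrow> 'a" where
  "inv_fun f \<equiv> inv_into UNIV f"

text \<open>
  In a semifield these are the pairs of right and left multiplication by an element of the middle
  nucleus; the condition itself refers to no identity element and is compatible with isotopisms.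
\<close>

definition adjoint_pairs :: "('a \<Rightarrow> 'a \<Rightarrow> 'a) \<Rightarrow> (('a \<Rightarrow> 'a) \<times> ('a \<Rightarrow> 'a)) set" where
  "adjoint_pairs m = {(f, g). \<forall>x y. m (f x) y = m x (g y)}"

text \<open>
  The analogue of \<open>adjoint_pairs\<close> for the center: in a semifield all three maps are multiplication
  by one central element. An isotopism conjugates the three components by three different maps,
  so they are kept apart.
\<close>

definition scalar_triples :: "('a \<Rightarrow> 'a \<Rightarrow> 'a) \<Rightarrow> (('a \<Rightarrow> 'a) \<times> ('a \<Rightarrow> 'a) \<times> ('a \<Rightarrow> 'a)) set" where
  "scalar_triples m = {(f, g, k). \<forall>x y. m (f x) y = k (m x y) \<and> m x (g y) = k (m x y)}"

definition isotopism where
  "isotopism m m' g1 g2 g3 \<longleftrightarrow>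
     bij g1 \<and> bij g2 \<and> bij g3 \<and> (\<forall>x y. m' (g1 x) (g2 y) = g3 (m x y))"

lemma isotopic_imp_isotopism:
  assumes "isotopic m m'"
  obtains g1 g2 g3 where "isotopism m m' g1 g2 g3"
  using assms unfolding isotopic_def isotopism_def by blast

lemma isotopism_inv:
  assumes "isotopism m m' g1 g2 g3"
  shows "isotopism m' m (inv_fun g1) (inv_fun g2) (inv_fun g3)"
proof -
  have b: "bij g1" "bij g2" "bij g3" using assms by (simp_all add: isotopism_def)
  have "m (inv_fun g1 x) (inv_fun g2 y) = inv_fun g3 (m' x y)" for x y
  proof -
    have "m' (g1 (inv_fun g1 x)) (g2 (inv_fun g2 y)) = g3 (m (inv_fun g1 x) (inv_fun g2 y))"
      using assms by (simp add: isotopism_def)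
    then have "m' x y = g3 (m (inv_fun g1 x) (inv_fun g2 y))"
      by (simp add: b[THEN bij_is_surj, THEN surj_f_inv_f])
    then show ?thesis using b by (simp add: bij_is_inj inv_f_f)
  qed
  then show ?thesis using b[THEN bij_imp_bij_inv] by (simp add: isotopism_def)
qed

lemma conj_conj_inv:
  assumes "bij g"
  shows "inv_fun g \<circ> (g \<circ> f \<circ> inv_fun g) \<circ> g = f" "g \<circ> (inv_fun g \<circ> f' \<circ> g) \<circ> inv_fun g = f'"
  using assms by (simp_all add: fun_eq_iff bij_is_inj bij_is_surj inv_f_f surj_f_inv_f)

lemma adjoint_pairs_transfer:
  assumes "isotopism m m' g1 g2 g3" and "(f, g) \<in> adjoint_pairs m"
  shows "(g1 \<circ> f \<circ> inv_fun g1, g2 \<circ> g \<circ> inv_fun g2) \<in> adjoint_pairs m'"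
proof -
  have b: "bij g1" "bij g2" "bij g3" and iso: "\<And>x y. m' (g1 x) (g2 y) = g3 (m x y)"
    using assms(1) by (simp_all add: isotopism_def)
  note cancel = b[THEN bij_is_surj, THEN surj_f_inv_f]
  have "m' (g1 (f (inv_fun g1 x))) y = m' x (g2 (g (inv_fun g2 y)))" for x y
    using iso[of "f (inv_fun g1 x)" "inv_fun g2 y"] iso[of "inv_fun g1 x" "g (inv_fun g2 y)"]
      assms(2) by (simp add: cancel adjoint_pairs_def)
  then show ?thesis by (simp add: adjoint_pairs_def)
qed

lemma scalar_triples_transfer:
  assumes "isotopism m m' g1 g2 g3" and "(f, g, k) \<in> scalar_triples m"
  shows "(g1 \<circ> f \<circ> inv_fun g1, g2 \<circ> g \<circ> inv_fun g2, g3 \<circ> k \<circ> inv_fun g3) \<in> scalar_triples m'"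
proof -
  have b: "bij g1" "bij g2" "bij g3" and iso: "\<And>x y. m' (g1 x) (g2 y) = g3 (m x y)"
    using assms(1) by (simp_all add: isotopism_def)
  note cancel = b[THEN bij_is_surj, THEN surj_f_inv_f]
  have descend: "m (inv_fun g1 x) (inv_fun g2 y) = inv_fun g3 (m' x y)" for x y
    using isotopism_inv[OF assms(1)] by (simp add: isotopism_def)
  have "m' (g1 (f (inv_fun g1 x))) y = g3 (k (inv_fun g3 (m' x y)))" for x y
    using iso[of "f (inv_fun g1 x)" "inv_fun g2 y"] assms(2)
    by (simp add: cancel descend scalar_triples_def)
  moreover have "m' x (g2 (g (inv_fun g2 y))) = g3 (k (inv_fun g3 (m' x y)))" for x y
    using iso[of "inv_fun g1 x" "g (inv_fun g2 y)"] assms(2)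
    by (simp add: cancel descend scalar_triples_def)
  ultimately show ?thesis by (simp add: scalar_triples_def)
qed

lemma isotopic_card_adjoint_pairs:
  assumes "isotopic m m'"
  shows "card (adjoint_pairs m) = card (adjoint_pairs m')"
proof -
  obtain g1 g2 g3 where iso: "isotopism m m' g1 g2 g3"
    using isotopic_imp_isotopism[OF assms] by blast
  then have b: "bij g1" "bij g2" "bij g3" by (simp_all add: isotopism_def)
  note inv_inv = b[THEN inv_inv_eq]
  let ?T = "\<lambda>(f, f'). (g1 \<circ> f \<circ> inv_fun g1, g2 \<circ> f' \<circ> inv_fun g2)"
  let ?U = "\<lambda>(f, f'). (inv_fun g1 \<circ> f \<circ> g1, inv_fun g2 \<circ> f' \<circ> g2)"
  have "bij_betw ?T (adjoint_pairs m) (adjoint_pairs m')"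
  proof (rule bij_betw_byWitness[where f' = ?U])
    show "?T ` adjoint_pairs m \<subseteq> adjoint_pairs m'"
      using adjoint_pairs_transfer[OF iso] by auto
    show "?U ` adjoint_pairs m' \<subseteq> adjoint_pairs m"
      using adjoint_pairs_transfer[OF isotopism_inv[OF iso]] by (auto simp: inv_inv)
  qed (auto simp: conj_conj_inv[OF b(1)] conj_conj_inv[OF b(2)])
  then show ?thesis by (rule bij_betw_same_card)
qed

lemma isotopic_card_scalar_triples:
  assumes "isotopic m m'"
  shows "card (scalar_triples m) = card (scalar_triples m')"
proof -
  obtain g1 g2 g3 where iso: "isotopism m m' g1 g2 g3"
    using isotopic_imp_isotopism[OF assms] by blast
  then have b: "bij g1" "bij g2" "bij g3" by (simp_all add: isotopism_def)
  note inv_inv = b[THEN inv_inv_eq]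
  let ?T = "\<lambda>(f, f', k). (g1 \<circ> f \<circ> inv_fun g1, g2 \<circ> f' \<circ> inv_fun g2, g3 \<circ> k \<circ> inv_fun g3)"
  let ?U = "\<lambda>(f, f', k). (inv_fun g1 \<circ> f \<circ> g1, inv_fun g2 \<circ> f' \<circ> g2, inv_fun g3 \<circ> k \<circ> g3)"
  have "bij_betw ?T (scalar_triples m) (scalar_triples m')"
  proof (rule bij_betw_byWitness[where f' = ?U])
    show "?T ` scalar_triples m \<subseteq> scalar_triples m'"
      using scalar_triples_transfer[OF iso] by auto
    show "?U ` scalar_triples m' \<subseteq> scalar_triples m"
      using scalar_triples_transfer[OF isotopism_inv[OF iso]] by (auto simp: inv_inv)
  qed (auto simp: conj_conj_inv[OF b(1)] conj_conj_inv[OF b(2)] conj_conj_inv[OF b(3)])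
  then show ?thesis by (rule bij_betw_same_card)
qed

text \<open>
  Setting one argument to the identity \<open>e\<close> in \<open>S (f x) y = S x (g y)\<close> shows that \<open>f\<close> and \<open>g\<close> are
  right and left multiplication by \<open>g e\<close>; the equation is then associativity with \<open>g e\<close> in the middle.
\<close>

lemma semifield_card_middle_nucleus:
  assumes "semifield S"
  shows "card (middle_nucleus S) = card (adjoint_pairs S)"
proof -
  obtain e where e: "\<And>x. S e x = x" "\<And>x. S x e = x"
    using assms unfolding semifield_def by blast
  have unique: "f = (\<lambda>x. S x (g e)) \<and> g = S (g e) \<and> g e \<in> middle_nucleus S"
    if "(f, g) \<in> adjoint_pairs S" for f g
  proof -
    define b where "b = g e"
    have fg: "S (f x) y = S x (g y)" for x y using that by (simp add: adjoint_pairs_def)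
    have f: "f x = S x b" for x using fg[of x e] by (simp add: e b_def)
    have g: "g y = S b y" for y using fg[of e y] f[of e] by (simp add: e)
    have "S (S x b) y = S x (S b y)" for x y using fg[of x y] by (simp add: f g)
    then show ?thesis using f g by (simp add: b_def[symmetric] middle_nucleus_def fun_eq_iff e)
  qed
  have "bij_betw (\<lambda>b. (\<lambda>x. S x b, S b)) (middle_nucleus S) (adjoint_pairs S)"
  proof (rule bij_betw_byWitness[where f' = "\<lambda>(f, g). g e"])
    show "\<forall>p\<in>adjoint_pairs S. (\<lambda>b. (\<lambda>x. S x b, S b)) ((\<lambda>(f, g). g e) p) = p"
      using unique by fastforce
    show "(\<lambda>(f, g). g e) ` adjoint_pairs S \<subseteq> middle_nucleus S"
      using unique by auto
  qed (auto simp: e middle_nucleus_def adjoint_pairs_def)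
  then show ?thesis by (rule bij_betw_same_card)
qed

text \<open>
  Setting one argument to the identity makes the three maps of a triple equal. The common map is
  both left and right multiplication by an element \<open>z\<close>, and the two equations of a triple then move
  \<open>z\<close> freely through every product.
\<close>

lemma semifield_card_center:
  assumes "semifield S"
  shows "card (semifield_center S) = card (scalar_triples S)"
proof -
  obtain e where e: "\<And>x. S e x = x" "\<And>x. S x e = x"
    using assms unfolding semifield_def by blast
  have unique: "f = S (f e) \<and> g = S (f e) \<and> k = S (f e) \<and> f e \<in> semifield_center S"
    if "(f, g, k) \<in> scalar_triples S" for f g k
  proof -
    have fk: "S (f x) y = k (S x y)" and gk: "S x (g y) = k (S x y)" for x y
      using that by (simp_all add: scalar_triples_def)
    have "f x = k x" "g x = k x" for x using fk[of x e] gk[of e x] e by simp_all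
    then have eq: "f = k" "g = k" by auto
    define z where "z = k e"
    have kL: "k x = S z x" for x using fk[of e x] e eq by (simp add: z_def)
    have kR: "k x = S x z" for x using gk[of x e] e eq by (simp add: z_def)
    have "z \<in> semifield_center S"
      unfolding semifield_center_def left_nucleus_def middle_nucleus_def right_nucleus_def
    proof (intro CollectI conjI IntI allI)
      fix x y
      show "S (S z x) y = S z (S x y)" using fk[of x y] kL[of x] kL[of "S x y"] eq by simp
      show "S (S x z) y = S x (S z y)" using fk[of x y] gk[of x y] kR[of x] kL[of y] eq by simp
      show "S (S x y) z = S x (S y z)" using gk[of x y] kR[of y] kR[of "S x y"] eq by simp
      show "S z x = S x z" using kL[of x] kR[of x] by simp
    qed
    then show ?thesis using eq kL by (auto simp: z_def[symmetric] fun_eq_iff e)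
  qed
  have "bij_betw (\<lambda>z. (S z, S z, S z)) (semifield_center S) (scalar_triples S)"
  proof (rule bij_betw_byWitness[where f' = "\<lambda>(f, g, k). f e"])
    show "(\<lambda>z. (S z, S z, S z)) ` semifield_center S \<subseteq> scalar_triples S"
    proof safe
      fix z assume z: "z \<in> semifield_center S"
      then have zx: "S z x = S x z" and left: "S (S z x) y = S z (S x y)"
        and mid: "S (S x z) y = S x (S z y)" for x y
        by (auto simp: semifield_center_def left_nucleus_def middle_nucleus_def)
      have "S x (S z y) = S z (S x y)" for x y
        using mid[of x y] zx[of x] left[of x y] by simp
      with left show "(S z, S z, S z) \<in> scalar_triples S" by (simp add: scalar_triples_def)
    qed
  qed (use unique e in auto)
  then show ?thesis by (rule bij_betw_same_card)
qed

text \<open>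
  Kaplansky's construction: for \<open>e \<noteq> 0\<close>, undoing the right and left multiplications by \<open>e\<close> in the
  two arguments turns \<open>m e e\<close> into an identity element.
\<close>

lemma presemifield_isotopic_semifield:
  fixes m :: "'a::{ab_group_add,finite} \<Rightarrow> 'a \<Rightarrow> 'a"
  assumes "presemifield m"
  shows "\<exists>S :: 'a \<Rightarrow> 'a \<Rightarrow> 'a. semifield S \<and> isotopic m S"
proof -
  have add: "m x (y + z) = m x y + m x z" "m (x + y) z = m x z + m y z" for x y z
    using assms by (simp_all add: presemifield_def)
  obtain e :: 'a where e: "e \<noteq> 0" using assms by (auto simp: presemifield_def)
  define L where "L = (\<lambda>x. m x e)"
  define R where "R = (\<lambda>y. m e y)"
  have b: "bij L" "bij R"
    using assms e unfolding presemifield_iff_bij L_def R_def by auto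
  have addL: "L (x + y) = L x + L y" and addR: "R (x + y) = R x + R y" for x y
    by (simp_all add: L_def R_def add)
  have L_inv: "L (inv_fun L x) = x" and R_inv: "R (inv_fun R x) = x"
    and inv_L: "inv_fun L (L x) = x" and inv_R: "inv_fun R (R x) = x" for x
    using b by (simp_all add: bij_is_inj bij_is_surj inv_f_f surj_f_inv_f)
  have inv_addL: "inv_fun L (x + y) = inv_fun L x + inv_fun L y" for x y
    using addL[of "inv_fun L x" "inv_fun L y"] by (metis L_inv inv_L)
  have inv_addR: "inv_fun R (x + y) = inv_fun R x + inv_fun R y" for x y
    using addR[of "inv_fun R x" "inv_fun R y"] by (metis R_inv inv_R)
  define S where "S = (\<lambda>a b. m (inv_fun L a) (inv_fun R b))"
  have iso: "S (L x) (R y) = m x y" for x y by (simp add: S_def inv_L inv_R)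
  have L0: "L 0 = 0" and R0: "R 0 = 0" using addL[of 0 0] addR[of 0 0] by simp_all
  have Le: "L e = R e" by (simp add: L_def R_def)
  have Re_nz: "R e \<noteq> 0" using e R0 inv_R by metis
  have "semifield S"
    unfolding semifield_def
  proof
    show "presemifield S"
      unfolding presemifield_def
    proof (intro conjI allI impI)
      show "\<exists>a::'a. a \<noteq> 0" using e by blast
      fix x y z
      show "S x (y + z) = S x y + S x z" "S (x + y) z = S x z + S y z"
        by (simp_all add: S_def inv_addL inv_addR add)
      assume "S x y = 0"
      then have "inv_fun L x = 0 \<or> inv_fun R y = 0"
        using assms by (auto simp: S_def presemifield_def)
      then show "x = 0 \<or> y = 0" using L_inv R_inv L0 R0 by metis
    qed
    have "S (R e) y = y" for y
      by (simp add: S_def Le[symmetric] inv_L) (simp add: R_inv flip: R_def[THEN fun_cong])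
    moreover have "S x (R e) = x" for x
      by (simp add: S_def inv_R) (simp add: L_inv flip: L_def[THEN fun_cong])
    ultimately show "\<exists>e. e \<noteq> 0 \<and> (\<forall>x. S e x = x \<and> S x e = x)"
      using Re_nz by blast
  qed
  moreover have "isotopic m S"
    unfolding isotopic_def
  proof (intro exI conjI allI)
    show "Modules.additive L" "Modules.additive R" "Modules.additive id"
      by (simp_all add: Modules.additive_def addL addR)
    show "bij L" "bij R" "bij (id :: 'a \<Rightarrow> 'a)" using b by simp_all
    show "S (L x) (R y) = id (m x y)" for x y by (simp add: iso)
  qed
  ultimately show ?thesis by blast
qed

section \<open>Powers of the Frobenius automorphism\<close>

locale frobenius_powers =
  fixes q d :: nat and u :: "'a::{field,finite}"
  assumes primepow: "primepow q" and card: "CARD('a) = q ^ d"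
    and primitive: "primitive_element u"
begin

definition frob :: "nat \<Rightarrow> 'a \<Rightarrow> 'a" ("\<phi>") where
  "\<phi> k x = x ^ (q ^ k)"

lemma q_gt_1: "q > 1"
  using primepow by (simp add: primepow_gt_Suc_0)

lemma d_pos: "d > 0"
proof (rule ccontr)
  assume "\<not> d > 0"
  then have "card {0::'a, 1} \<le> 1" using card by (metis card_mono finite subset_UNIV power_0 not_gr_zero)
  then show False by simp
qed

lemma prime_power_CHAR: "\<exists>k. q = CHAR('a) ^ k"
proof -
  obtain p k where p: "prime p" "q = p ^ k" using primepow by (auto simp: primepow_def)
  have prime: "prime CHAR('a)"
    using finite_imp_CHAR_pos[OF finite[of "UNIV :: 'a set"]] by (rule prime_CHAR_semidom)
  have "CHAR('a) dvd p ^ (k * d)" using CHAR_dvd_CARD[where 'a = 'a] card p by (simp add: power_mult)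
  then have "CHAR('a) = p" using prime p(1) by (metis prime_dvd_power primes_dvd_imp_eq)
  then show ?thesis using p(2) by blast
qed

lemma of_nat_q: "of_nat q = (0::'a)"
proof -
  have "of_nat (q ^ d) = (0::'a)"
    using CHAR_dvd_CARD[where 'a = 'a] card by (simp only: of_nat_eq_0_iff_char_dvd)
  then show ?thesis by simp
qed

lemma u_nonzero: "u \<noteq> 0"
  using primitive by (metis DiffE UNIV_I insertI1 power_one_right primitive_element_def rangeI)

lemma primitiveE:
  assumes "x \<noteq> 0"
  obtains k where "x = u ^ k"
  using assms primitive unfolding primitive_element_def by blast

lemma power_card: "x ^ (q ^ d) = (x::'a)"
proof (cases "x = 0")
  case True
  then show ?thesis using q_gt_1 by simp
next
  case False
  let ?U = "UNIV - {0::'a}"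
  have "bij_betw ((*) x) ?U ?U"
    by (rule bij_betw_byWitness[where f' = "(*) (inverse x)"])
      (use False in \<open>auto simp: field_simps\<close>)
  then have "(\<Prod>y\<in>?U. x * y) = \<Prod>?U" by (rule prod.reindex_bij_betw)
  then have "x ^ card ?U * \<Prod>?U = \<Prod>?U" by (simp add: prod.distrib)
  then have "x ^ card ?U = 1" by simp
  moreover have "Suc (card ?U) = q ^ d"
    by (metis card card_Suc_Diff1 finite UNIV_I)
  ultimately show ?thesis by (metis power_Suc mult.right_neutral)
qed

lemma u_power_neq_1:
  assumes "0 < k" "k < q ^ d - 1"
  shows "u ^ k \<noteq> 1"
proof
  assume one: "u ^ k = 1"
  have "UNIV - {0} \<subseteq> (\<lambda>i. u ^ i) ` {..<k}"
  proof
    fix x :: 'a assume "x \<in> UNIV - {0}"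
    then obtain i where "x = u ^ i" using primitiveE by blast
    also have "\<dots> = u ^ (k * (i div k) + i mod k)" by simp
    also have "\<dots> = u ^ (i mod k)" by (simp only: power_add power_mult one power_one mult_1)
    finally show "x \<in> (\<lambda>i. u ^ i) ` {..<k}" using assms by auto
  qed
  then have "card (UNIV - {0::'a}) \<le> card {..<k}"
    by (meson card_image_le card_mono finite_imageI finite_lessThan le_trans)
  then show False using assms card by (simp add: card_Diff_singleton)
qed

lemma u_power_inj:
  assumes "u ^ i = u ^ j" "i < q ^ d - 1" "j < q ^ d - 1"
  shows "i = j"
proof -
  have False if "u ^ i = u ^ j" "i < j" "j < q ^ d - 1" for i j
  proof -
    have "u ^ i * u ^ (j - i) = u ^ i * 1"
      using that(1,2) by (metis le_add_diff_inverse less_imp_le mult_1_right power_add)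
    then have "u ^ (j - i) = 1" using u_nonzero by simp
    then show False using u_power_neq_1[of "j - i"] that by simp
  qed
  then show ?thesis using assms by (metis linorder_neqE_nat)
qed

lemma frob_add: "\<phi> k (x + y) = \<phi> k x + \<phi> k y"
proof -
  obtain e where e: "q = CHAR('a) ^ e" using prime_power_CHAR by blast
  have prime: "prime CHAR('a)"
    using finite_imp_CHAR_pos[OF finite[of "UNIV :: 'a set"]] by (rule prime_CHAR_semidom)
  have "q ^ k = CHAR('a) ^ (e * k)" by (subst e) (simp add: power_mult)
  then show ?thesis unfolding frob_def by (rule freshmans_dream'[OF prime])
qed

lemma frob_0 [simp]: "\<phi> k 0 = 0"
  using q_gt_1 by (simp add: frob_def)

lemma frob_1 [simp]: "\<phi> k 1 = 1" by (simp add: frob_def)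

lemma frob_minus: "\<phi> k (- x) = - \<phi> k x"
  using frob_add[of k x "- x"] by (simp add: eq_neg_iff_add_eq_0 add.commute)

lemma frob_diff: "\<phi> k (x - y) = \<phi> k x - \<phi> k y"
  using frob_add[of k x "- y"] by (simp add: frob_minus)

lemma frob_mult: "\<phi> k (x * y) = \<phi> k x * \<phi> k y"
  by (simp add: frob_def power_mult_distrib)

lemma frob_power: "\<phi> k (x ^ m) = \<phi> k x ^ m"
  by (simp add: frob_def power_commutes flip: power_mult) (simp add: mult.commute)

lemma frob_divide: "\<phi> k (x / y) = \<phi> k x / \<phi> k y"
  by (simp add: frob_def power_divide)

lemma frob_prod: "\<phi> k (\<Prod>i\<in>A. f i) = (\<Prod>i\<in>A. \<phi> k (f i))"
  by (simp add: frob_def prod_power_distrib)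

lemmas frob_ring = frob_add frob_diff frob_minus frob_mult frob_power frob_divide

lemma frob_frob: "\<phi> i (\<phi> j x) = \<phi> (i + j) x"
  by (simp add: frob_def power_add mult.commute flip: power_mult)

lemma frob_id [simp]: "\<phi> 0 x = x" by (simp add: frob_def)

lemma frob_d [simp]: "\<phi> d x = x" by (simp add: frob_def power_card)

lemma frob_mult_fixed:
  assumes "\<phi> i x = x"
  shows "\<phi> (i * k) x = x"
proof (induction k)
  case (Suc k)
  then show ?case using frob_frob[of i "i * k" x] assms by simp
qed simp

lemma frob_add_mult_d: "\<phi> (i + d * k) x = \<phi> i x"
  by (simp add: frob_mult_fixed flip: frob_frob)

lemma frob_mod: "\<phi> (i mod d) x = \<phi> i x"
  using frob_add_mult_d[of "i mod d" "i div d" x] by simp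

lemma frob_cong: "[i = j] (mod d) \<Longrightarrow> \<phi> i x = \<phi> j x"
  by (metis cong_def frob_mod)

lemma frob_eq_0_iff [simp]: "\<phi> k x = 0 \<longleftrightarrow> x = 0"
  using q_gt_1 by (simp add: frob_def)

lemma frob_eq_iff [simp]: "\<phi> k x = \<phi> k y \<longleftrightarrow> x = y"
  using frob_eq_0_iff[of k "x - y"] by (simp add: frob_diff del: frob_eq_0_iff)

text \<open>
  A Bezout identity in the form \<open>i * a = j * b + gcd i j\<close> stays within the natural numbers.
\<close>

lemma frob_fixed_gcd:
  assumes "\<phi> i x = x" "\<phi> j x = x"
  shows "\<phi> (gcd i j) x = x"
proof (cases "i = 0")
  case False
  then obtain a b where "i * a = j * b + gcd i j" using bezout_nat by blast
  then have "\<phi> (i * a) x = \<phi> (gcd i j) (\<phi> (j * b) x)" by (simp add: frob_frob add.commute)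
  then show ?thesis using assms by (simp add: frob_mult_fixed)
qed (use assms in simp)

lemma frob_fixed_dvd:
  assumes "\<phi> i x = x" "\<phi> j x = x" "gcd i j dvd k"
  shows "\<phi> k x = x"
  using frob_fixed_gcd[OF assms(1,2)] assms(3) frob_mult_fixed by (metis dvd_def)

lemma frob_u_eq_iff: "\<phi> i u = \<phi> j u \<longleftrightarrow> [i = j] (mod d)"
proof
  assume eq: "\<phi> i u = \<phi> j u"
  show "[i = j] (mod d)"
  proof (cases "d = 1")
    case False
    have small: "q ^ (k mod d) < q ^ d - 1" for k
    proof -
      have "q ^ (k mod d) \<le> q ^ (d - 1)" using d_pos q_gt_1
        by (intro power_increasing) (auto simp: less_Suc_eq_le[symmetric])
      moreover have "q ^ d = q * q ^ (d - 1)" using d_pos by (simp flip: power_Suc)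
      moreover have "2 \<le> q ^ (d - 1)"
        using power_increasing[of 1 "d - 1" q] False d_pos q_gt_1 by (simp add: Suc_le_eq)
      moreover have "2 * q ^ (d - 1) \<le> q * q ^ (d - 1)" using q_gt_1 by simp
      ultimately show ?thesis by linarith
    qed
    have "u ^ (q ^ (i mod d)) = u ^ (q ^ (j mod d))"
      using eq frob_mod[of _ u] by (simp add: frob_def)
    then have "q ^ (i mod d) = q ^ (j mod d)" using small u_power_inj by blast
    then show ?thesis using q_gt_1 by (simp add: cong_def)
  qed simp
qed (rule frob_cong)

text \<open>
  With \<open>M = (q ^ d - 1) / (q - 1)\<close>, a power \<open>u ^ k\<close> is fixed by \<open>x \<mapsto> x ^ q\<close> exactly if \<open>M\<close> divides
  \<open>k\<close>, which leaves \<open>q - 1\<close> nonzero fixed elements.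
\<close>

lemma card_subfield: "card {c. \<phi> 1 c = c} = q"
proof -
  define M where "M = (\<Sum>i<d. q ^ i)"
  have M: "(q - 1) * M = q ^ d - 1"
    using q_gt_1 power_diff_1_eq[of "int q" d]
    by (simp add: M_def of_nat_diff flip: of_nat_eq_iff[where 'a = int])
  have M_pos: "M > 0" using M q_gt_1 d_pos
    by (metis One_nat_def mult_0_right not_gr_zero one_less_power zero_less_diff)
  have "{c. \<phi> 1 c = c} = insert 0 ((\<lambda>j. u ^ (M * j)) ` {..<q - 1})"
  proof safe
    fix c assume c: "\<phi> 1 c = c" "c \<notin> (\<lambda>j. u ^ (M * j)) ` {..<q - 1}"
    show "c = 0"
    proof (rule ccontr)
      assume "c \<noteq> 0"
      then obtain k' where k': "c = u ^ k'" using primitiveE by blast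
      define k where "k = k' mod (q ^ d - 1)"
      have uN: "u ^ (q ^ d - 1) = 1"
        using power_card[of u] u_nonzero q_gt_1
        by (metis power_minus_mult mult_cancel_right1 zero_less_power less_trans zero_less_one)
      have "u ^ k' = u ^ ((q ^ d - 1) * (k' div (q ^ d - 1)) + k)" by (simp add: k_def)
      also have "\<dots> = u ^ k" by (simp only: power_add power_mult uN power_one mult_1)
      finally have ck: "c = u ^ k" using k' by simp
      have k_less: "k < q ^ d - 1" using q_gt_1 d_pos one_less_power[of q d] by (simp add: k_def)
      have "c ^ q = c" using c(1) by (simp add: frob_def)
      then have "c * c ^ (q - 1) = c * 1" using q_gt_1 by (simp flip: power_Suc)
      then have "c ^ (q - 1) = 1" using \<open>c \<noteq> 0\<close> by (metis mult_left_cancel)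
      then have one: "u ^ (k * (q - 1)) = 1" by (simp add: ck power_mult)
      define r where "r = k * (q - 1) mod (q ^ d - 1)"
      have "u ^ (k * (q - 1)) = u ^ ((q ^ d - 1) * (k * (q - 1) div (q ^ d - 1)) + r)"
        by (simp add: r_def)
      also have "\<dots> = u ^ r" by (simp only: power_add power_mult uN power_one mult_1)
      finally have "u ^ r = 1" using one by simp
      moreover have "r < q ^ d - 1" using k_less by (simp add: r_def)
      ultimately have "r = 0" using u_power_neq_1 by blast
      then have "(q - 1) * M dvd (q - 1) * k" unfolding r_def M by (simp add: mult.commute dvd_eq_mod_eq_0)
      then have "M dvd k" using q_gt_1 by simp
      then obtain j where j: "k = M * j" by blast
      have "M * j < M * (q - 1)" using k_less j M by (simp add: mult.commute)
      then have "j < q - 1" using M_pos by simp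
      then show False using c(2) ck j by blast
    qed
  next
    fix j
    have "M * j * (q - 1) = (q ^ d - 1) * j" by (simp only: M[symmetric] ac_simps)
    then have "u ^ (M * j) * u ^ (M * j * (q - 1)) = u ^ (M * j) * (u ^ (q ^ d - 1)) ^ j"
      by (simp only: power_mult)
    moreover have "u ^ (q ^ d - 1) = 1"
      using power_card[of u] u_nonzero q_gt_1
      by (metis power_minus_mult mult_cancel_right1 zero_less_power less_trans zero_less_one)
    ultimately have "u ^ (M * j + M * j * (q - 1)) = u ^ (M * j)" by (simp add: power_add)
    moreover have "M * j + M * j * (q - 1) = M * j * q" using q_gt_1
      by (metis Suc_diff_1 less_trans mult_Suc_right zero_less_one)
    ultimately show "\<phi> 1 (u ^ (M * j)) = u ^ (M * j)" by (simp add: frob_def power_mult)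
  qed simp
  moreover have "inj_on (\<lambda>j. u ^ (M * j)) {..<q - 1}"
  proof (rule inj_onI)
    fix i j assume ij: "i \<in> {..<q - 1}" "j \<in> {..<q - 1}" "u ^ (M * i) = u ^ (M * j)"
    have "i * M < (q - 1) * M" "j * M < (q - 1) * M" using ij M_pos by simp_all
    then have "M * i < q ^ d - 1" "M * j < q ^ d - 1" unfolding M by (simp_all add: mult.commute)
    then have "M * i = M * j" using ij(3) u_power_inj by blast
    then show "i = j" using M_pos by simp
  qed
  ultimately show ?thesis using u_nonzero q_gt_1 by (simp add: card_image card_insert_if image_iff)
qed

lemma power_q_minus_1_eq_1:
  assumes "\<phi> 1 c = c" "c \<noteq> 0"
  shows "c ^ (q - 1) = 1"
proof -
  have "c * c ^ (q - 1) = c * 1" using assms q_gt_1 by (simp add: frob_def flip: power_Suc)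
  then show ?thesis using assms(2) by simp
qed

subsection \<open>Coefficients with respect to the Frobenius powers\<close>

text \<open>
  On a linear combination of the functions \<open>\<phi> i\<close> this reads off the coefficient of \<open>\<phi> i\<close>. It is
  defined for arbitrary functions so that it can be applied to maps that are still to be shown to be
  such combinations.
\<close>

definition coef :: "nat \<Rightarrow> ('a \<Rightarrow> 'a) \<Rightarrow> 'a" where
  "coef i g = - (\<Sum>x\<in>UNIV - {0}. g x / \<phi> i x)"

lemma coef_add: "coef i (\<lambda>x. f x + g x) = coef i f + coef i g"
  by (simp add: coef_def add_divide_distrib sum.distrib)

lemma coef_scale: "coef i (\<lambda>x. c * g x) = c * coef i g"
  by (simp add: coef_def sum_distrib_left)

text \<open>
  The quotient \<open>\<phi> j x / \<phi> i x\<close> is a character of the multiplicative group. If it is trivial, the sum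
  is \<open>q ^ d - 1 = - 1\<close>; if not, its value at \<open>u\<close> differs from \<open>1\<close>, and shifting the summation by \<open>u\<close>
  shows that the sum vanishes.
\<close>

lemma coef_frob: "coef i (\<phi> j) = (if [i = j] (mod d) then 1 else 0)"
proof (cases "[i = j] (mod d)")
  case True
  have "coef i (\<phi> j) = - (\<Sum>x\<in>UNIV - {0::'a}. 1)"
    unfolding coef_def using frob_cong[OF True] by (auto intro!: sum.cong)
  also have "\<dots> = - (of_nat (q ^ d - 1))" by (simp add: card card_Diff_singleton)
  also have "\<dots> = 1" using q_gt_1 d_pos of_nat_q by (subst of_nat_diff) (auto simp: Suc_le_eq)
  finally show ?thesis using True by simp
next
  case False
  let ?U = "UNIV - {0::'a}"
  define \<chi> where "\<chi> = (\<lambda>x. \<phi> j x / \<phi> i x)"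
  have "\<chi> u \<noteq> 1" using False frob_u_eq_iff[of i j] u_nonzero by (auto simp: \<chi>_def divide_eq_1_iff)
  \<comment> \<open>Shift the summation variable by \<open>u\<close>.\<close>
  have "bij_betw ((*) u) ?U ?U"
    by (rule bij_betw_byWitness[where f' = "(*) (inverse u)"])
      (use u_nonzero in \<open>auto simp: field_simps\<close>)
  then have "(\<Sum>x\<in>?U. \<chi> (u * x)) = sum \<chi> ?U" by (rule sum.reindex_bij_betw)
  moreover have "(\<Sum>x\<in>?U. \<chi> (u * x)) = \<chi> u * sum \<chi> ?U"
    by (simp add: \<chi>_def frob_mult sum_distrib_left)
  ultimately have "(\<chi> u - 1) * sum \<chi> ?U = 0" by (simp add: algebra_simps)
  then have "sum \<chi> ?U = 0" using \<open>\<chi> u \<noteq> 1\<close> by simp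
  then show ?thesis using False by (simp add: coef_def \<chi>_def)
qed

lemma coef_id: "coef i (\<lambda>x. x) = (if [i = 0] (mod d) then 1 else 0)"
  using coef_frob[of i 0] by (simp add: coef_def)

lemma coef_frobs:
  "coef i (\<lambda>x. a * \<phi> j x + b * \<phi> k x + c * \<phi> l x + e * \<phi> m x)
    = (if [i = j] (mod d) then a else 0) + (if [i = k] (mod d) then b else 0)
    + (if [i = l] (mod d) then c else 0) + (if [i = m] (mod d) then e else 0)"
  by (simp add: coef_add coef_scale coef_frob)

subsection \<open>Orbit products and norms\<close>

text \<open>
  The product over the first \<open>D\<close> points of the orbit of \<open>x\<close> under \<open>\<phi> c\<close>. For \<open>c * D = d\<close> it is the
  norm onto the fixed field of \<open>\<phi> c\<close>; the partial products are used as well.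
\<close>

definition rel_norm :: "nat \<Rightarrow> nat \<Rightarrow> 'a \<Rightarrow> 'a" where
  "rel_norm c D x = (\<Prod>j<D. \<phi> (c * j) x)"

lemma rel_norm_eq_power: "rel_norm c D x = x ^ (\<Sum>j<D. q ^ (c * j))"
  by (simp add: rel_norm_def frob_def power_sum)

lemma rel_norm_mult: "rel_norm c D (x * y) = rel_norm c D x * rel_norm c D y"
  by (simp add: rel_norm_def frob_mult prod.distrib)

lemma rel_norm_nonzero: "x \<noteq> 0 \<Longrightarrow> rel_norm c D x \<noteq> 0"
  by (simp add: rel_norm_def)

lemma frob_rel_norm: "\<phi> i (rel_norm c D x) = rel_norm c D (\<phi> i x)"
  by (simp add: rel_norm_def frob_prod frob_frob add.commute)

lemma rel_norm_Suc: "rel_norm c (Suc D) x = rel_norm c D x * \<phi> (c * D) x"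
  by (simp add: rel_norm_def)

lemma rel_norm_add: "rel_norm c (i + j) x = rel_norm c i x * \<phi> (c * i) (rel_norm c j x)"
  by (induction j) (simp_all add: rel_norm_def frob_mult frob_prod frob_frob distrib_left mult.assoc)

lemma rel_norm_Suc_shift: "rel_norm c (Suc D) x = x * \<phi> c (rel_norm c D x)"
  using rel_norm_add[of c 1 D x] by (simp add: rel_norm_def)

lemma rel_norm_fixed:
  assumes "\<phi> (c * D) x = x"
  shows "\<phi> c (rel_norm c D x) = rel_norm c D x"
proof (cases "x = 0")
  case True
  then show ?thesis by (cases D) (simp_all add: rel_norm_def)
next
  case False
  have "x * \<phi> c (rel_norm c D x) = rel_norm c D x * x"
    using rel_norm_Suc[of c D x] rel_norm_Suc_shift[of c D x] assms by simp
  then show ?thesis using False by simp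
qed

text \<open>
  If \<open>m\<close> is prime to \<open>D\<close>, then \<open>\<phi> (c * m)\<close> runs through the same orbit of \<open>x\<close> as \<open>\<phi> c\<close>, in a
  different order.
\<close>

lemma rel_norm_generator:
  assumes "\<phi> (c * D) x = x" "coprime m D"
  shows "rel_norm (c * m) D x = rel_norm c D x"
proof (cases "D = 0")
  case False
  have period: "\<phi> (c * (i mod D)) x = \<phi> (c * i) x" for i
  proof -
    have "\<phi> (c * i) x = \<phi> (c * (i mod D)) (\<phi> (c * D * (i div D)) x)"
      by (simp add: frob_frob mult.assoc flip: distrib_left)
    then show ?thesis using frob_mult_fixed[OF assms(1)] by simp
  qed
  have "inj_on (\<lambda>i. i * m mod D) {..<D}"
  proof (rule inj_onI)
    fix i j assume ij: "i \<in> {..<D}" "j \<in> {..<D}" "i * m mod D = j * m mod D"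
    then have "[i = j] (mod D)" using cong_mult_rcancel_nat[OF assms(2)] by (simp add: cong_def)
    then show "i = j" using ij by (simp add: cong_def)
  qed
  moreover have "(\<lambda>i. i * m mod D) ` {..<D} \<subseteq> {..<D}" using False by auto
  ultimately have bij: "bij_betw (\<lambda>i. i * m mod D) {..<D} {..<D}"
    by (simp add: bij_betw_def endo_inj_surj)
  have "rel_norm (c * m) D x = (\<Prod>i<D. \<phi> (c * (i * m mod D)) x)"
    by (simp add: rel_norm_def period) (simp add: ac_simps)
  also have "\<dots> = rel_norm c D x"
    unfolding rel_norm_def by (rule prod.reindex_bij_betw[OF bij])
  finally show ?thesis .
qed (simp add: rel_norm_def)

end

section \<open>The cubic subextension\<close>

locale cubic_extension = frobenius_powers q "3 * h" u for q h and u :: "'a::{field,finite}" +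
  fixes n :: nat
  assumes coprime_h_n: "coprime h n"
begin

definition K :: "'a set" where "K = {c. \<phi> h c = c}"

lemma h_pos: "h > 0" using d_pos by simp

lemma frob_3h [simp]: "\<phi> (3 * h) x = x" by (rule frob_d)

lemma K_closed [simp]:
  "0 \<in> K" "1 \<in> K"
  "a \<in> K \<Longrightarrow> b \<in> K \<Longrightarrow> a + b \<in> K"
  "a \<in> K \<Longrightarrow> b \<in> K \<Longrightarrow> a - b \<in> K"
  "a \<in> K \<Longrightarrow> - a \<in> K"
  "a \<in> K \<Longrightarrow> b \<in> K \<Longrightarrow> a * b \<in> K"
  "a \<in> K \<Longrightarrow> b \<in> K \<Longrightarrow> a / b \<in> K"
  by (simp_all add: K_def frob_ring)

lemma frob_in_K [simp]: "a \<in> K \<Longrightarrow> \<phi> i a \<in> K"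
proof -
  assume "a \<in> K"
  then have "\<phi> i (\<phi> h a) = \<phi> i a" by (simp add: K_def)
  then show ?thesis by (simp add: K_def frob_frob add.commute)
qed

lemma K_fixed: "a \<in> K \<Longrightarrow> h dvd i \<Longrightarrow> \<phi> i a = a"
  by (auto simp: K_def frob_mult_fixed)

lemma K_if_fixed:
  assumes "\<phi> i x = x" "gcd i (3 * h) = h"
  shows "x \<in> K"
  using frob_fixed_gcd[OF assms(1) frob_3h] assms(2) by (simp add: K_def)

lemma coprime_h_plus_n: "coprime (h + n) h"
  using coprime_h_n unfolding coprime_iff_gcd_eq_1 by (metis add.commute gcd.commute gcd_add1)

lemma fixed_1_if_K:
  assumes "c \<in> K" "\<phi> (h + n) c = c"
  shows "\<phi> 1 c = c"
proof -
  have "gcd h (h + n) = 1" using coprime_h_n by simp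
  then show ?thesis using frob_fixed_gcd[of h c "h + n"] assms by (simp add: K_def)
qed

lemma K_linear_unique:
  assumes "s \<notin> K" "a \<in> K" "b \<in> K" "a' \<in> K" "b' \<in> K" "a * s + b = a' * s + b'"
  shows "a = a'" "b = b'"
proof -
  show "a = a'"
  proof (rule ccontr)
    assume "a \<noteq> a'"
    then have "s = (b' - b) / (a - a')" using assms(6) by (simp add: field_simps)
    then show False using assms(1-5) by simp
  qed
  then show "b = b'" using assms(6) by simp
qed

text \<open>
  The three conjugates of \<open>s\<close> over \<open>K\<close> are distinct, too many for the roots of a quadratic polynomial.
\<close>

lemma no_quadratic_over_K:
  assumes "s \<notin> K" "a \<in> K" "b \<in> K" "c \<in> K" "a * s * s + b * s + c = 0"
  shows "a = 0" "b = 0" "c = 0"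
proof -
  show a: "a = 0"
  proof (rule ccontr)
    assume "a \<noteq> 0"
    define e where "e = - b / a"
    define s1 where "s1 = \<phi> h s"
    define s2 where "s2 = \<phi> h s1"
    have eK: "\<phi> h e = e" using assms by (simp add: e_def K_def frob_ring)
    have "h + (h + h) = 3 * h" by simp
    then have s0: "\<phi> h s2 = s" by (simp only: s1_def s2_def frob_frob frob_3h)
    have ne: "s \<noteq> s1" "s1 \<noteq> s2" "s2 \<noteq> s"
      using assms(1) s0 by (auto simp: K_def s1_def s2_def)
    have fixed: "\<phi> h a = a" "\<phi> h b = b" "\<phi> h c = c" using assms by (simp_all add: K_def)
    have q0: "a * s * s + b * s + c = 0" by fact
    have q1: "a * s1 * s1 + b * s1 + c = 0"
      using arg_cong[OF q0, of "\<phi> h"] by (simp add: frob_ring fixed s1_def)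
    have q2: "a * s2 * s2 + b * s2 + c = 0"
      using arg_cong[OF q1, of "\<phi> h"] by (simp add: frob_ring fixed s2_def)
    have "(s - s1) * (a * (s + s1) + b) = (a * s * s + b * s + c) - (a * s1 * s1 + b * s1 + c)"
      by (simp add: algebra_simps)
    then have "(s - s1) * (a * (s + s1) + b) = 0" by (simp only: q0 q1 diff_self)
    then have "a * (s + s1) + b = 0" using ne by simp
    moreover have "(s1 - s2) * (a * (s1 + s2) + b) =
        (a * s1 * s1 + b * s1 + c) - (a * s2 * s2 + b * s2 + c)"
      by (simp add: algebra_simps)
    then have "(s1 - s2) * (a * (s1 + s2) + b) = 0" by (simp only: q1 q2 diff_self)
    then have "a * (s1 + s2) + b = 0" using ne by simp
    moreover have "a * (s - s2) = (a * (s + s1) + b) - (a * (s1 + s2) + b)"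
      by (simp add: algebra_simps)
    ultimately have "a * (s - s2) = 0" by simp
    then show False using ne \<open>a \<noteq> 0\<close> by simp
  qed
  show "b = 0" "c = 0" using K_linear_unique[of s b c 0 0] assms a by simp_all
qed

end

section \<open>Elements moved by a Moebius transformation\<close>

text \<open>
  The relation says that \<open>\<rho> = \<phi> (h + n)\<close> maps \<open>s\<close> to \<open>(\<epsilon> * s + \<delta>) / s\<close>, a Moebius transformation
  over \<open>K\<close> whose denominator is \<open>s\<close> itself. Denominators of composed Moebius transformations multiply
  along the orbit. Hence each product \<open>s * \<rho> s * \<dots> * \<rho> ^ (k - 1) s\<close>, called \<open>P k\<close> below, is the
  denominator of \<open>\<rho> ^ k\<close> at \<open>s\<close>, and so it has the form \<open>a * s + b\<close> with \<open>a\<close> and \<open>b\<close> in \<open>K\<close>.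
\<close>

locale moebius_orbit = cubic_extension q h u n
  for q h n and u :: "'a::{field,finite}" +
  fixes s \<epsilon> \<delta> :: 'a
  assumes s_notin_K: "s \<notin> K" and \<epsilon>_in_K: "\<epsilon> \<in> K" and \<delta>_in_K: "\<delta> \<in> K"
    and relation: "s * \<phi> (h + n) s = \<epsilon> * s + \<delta>"
begin

abbreviation P :: "nat \<Rightarrow> 'a" where "P k \<equiv> rel_norm (h + n) k s"

lemma s_nonzero: "s \<noteq> 0" using s_notin_K by auto

text \<open>
  The composed transformation is extended by one factor at the start of the orbit here, and at its end
  in \<open>P_Suc_Suc\<close>. The comparison of both recurrences yields the invariance of a trace in \<open>norm_cube\<close>.
\<close>

lemma P_Suc:
  assumes "P k = a * s + b"
  shows "P (Suc k) = (\<epsilon> * \<phi> (h + n) a + \<phi> (h + n) b) * s + \<delta> * \<phi> (h + n) a"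
proof -
  have "P (Suc k) = \<phi> (h + n) a * (s * \<phi> (h + n) s) + \<phi> (h + n) b * s"
    by (simp add: rel_norm_Suc_shift assms frob_ring algebra_simps)
  then show ?thesis by (simp add: relation algebra_simps)
qed

lemma P_Suc_Suc:
  "P (Suc (Suc k)) = \<phi> ((h + n) * k) \<epsilon> * P (Suc k) + \<phi> ((h + n) * k) \<delta> * P k"
proof -
  have "P (Suc (Suc k)) = P k * \<phi> ((h + n) * k) (s * \<phi> (h + n) s)"
    by (simp add: rel_norm_Suc frob_mult frob_frob add.commute)
  then show ?thesis by (simp add: relation frob_ring rel_norm_Suc algebra_simps)
qed

lemma P_linear: "\<exists>a\<in>K. \<exists>b\<in>K. P k = a * s + b"
proof (induction k)
  case 0
  show ?case by (rule bexI[of _ 0], rule bexI[of _ 1]) (simp_all add: rel_norm_def)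
next
  case (Suc k)
  then obtain a b where "a \<in> K" "b \<in> K" "P k = a * s + b" by blast
  then show ?case using P_Suc[of k a b] \<epsilon>_in_K \<delta>_in_K by (metis K_closed(3,6) frob_in_K)
qed

text \<open>
  As \<open>3\<close> divides \<open>h + n\<close>, the power \<open>\<rho> ^ h\<close> is the identity, so its Moebius transformation fixes \<open>s\<close>.
  An element outside \<open>K\<close> satisfies no quadratic equation over \<open>K\<close>, so the matrix is scalar and the
  denominator \<open>P h\<close>, which is the norm of \<open>s\<close> onto the fixed field of \<open>\<phi> 3\<close>, lies in \<open>K\<close>. Being
  fixed by \<open>\<phi> h\<close> and by \<open>\<rho>\<close>, it is fixed by \<open>\<phi> 1\<close>.
\<close>

lemma norm_fixed:
  assumes "3 dvd h + n"
  shows "\<phi> 1 (rel_norm 3 h s) = rel_norm 3 h s"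
proof -
  obtain m where m: "h + n = 3 * m" using assms by blast
  have norm: "P h = rel_norm 3 h s"
    unfolding m by (rule rel_norm_generator) (use coprime_h_plus_n m in simp_all)
  have per: "\<phi> ((h + n) * h) s = s"
    using frob_mult_fixed[OF frob_3h, of m s] by (simp add: m ac_simps)
  obtain a b where ab: "a \<in> K" "b \<in> K" "P h = a * s + b" using P_linear by blast
  define a' where "a' = \<epsilon> * \<phi> (h + n) a + \<phi> (h + n) b"
  define b' where "b' = \<delta> * \<phi> (h + n) a"
  have K': "a' \<in> K" "b' \<in> K" using ab \<epsilon>_in_K \<delta>_in_K by (simp_all add: a'_def b'_def)
  have "P (Suc h) = P h * s" by (simp add: rel_norm_Suc per)
  then have "a * s * s + (b - a') * s + (- b') = 0"
    using P_Suc[OF ab(3)] ab(3) by (simp add: a'_def b'_def algebra_simps)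
  moreover have "b - a' \<in> K" "- b' \<in> K" using ab K' by simp_all
  ultimately have "a = 0" using no_quadratic_over_K(1)[OF s_notin_K ab(1)] by blast
  then have "P h \<in> K" using ab by simp
  moreover have "\<phi> (h + n) (P h) = P h" by (rule rel_norm_fixed) (fact per)
  ultimately show ?thesis using fixed_1_if_K norm by simp
qed

text \<open>
  Now \<open>\<sigma> = \<rho> ^ h\<close> generates the automorphisms of \<open>F\<close> over \<open>K\<close>. Let \<open>M\<close> be its matrix, with rows
  \<open>(a', b')\<close> and \<open>(a, b)\<close>, trace \<open>t\<close> and determinant \<open>d\<close>. It permutes the three conjugates of \<open>s\<close>
  cyclically, so \<open>M ^ 3\<close> is the scalar matrix given by the norm of \<open>s\<close>. By Cayley-Hamilton
  \<open>M ^ 3 = (t\<^sup>2 - d) M - t d\<close>, and as \<open>M\<close> itself is not scalar, \<open>t\<^sup>2 = d\<close> and the norm is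
  \<open>- t * d = (- t) ^ 3\<close>. The image of \<open>M\<close> under \<open>\<rho>\<close> is conjugate to \<open>M\<close>, so \<open>t\<close> is fixed by \<open>\<rho>\<close>.
\<close>

lemma norm_cube:
  assumes "\<not> 3 dvd h + n"
  shows "\<exists>t. \<phi> 1 t = t \<and> rel_norm 1 (3 * h) s = t ^ 3"
proof -
  have cop3: "coprime (h + n) 3"
    using prime_imp_coprime[of 3 "h + n"] assms by (simp add: coprime_commute)
  have cop: "coprime (h + n) (3 * h)" using coprime_h_plus_n cop3 by simp
  have norm: "P (3 * h) = rel_norm 1 (3 * h) s"
    using rel_norm_generator[of 1 "3 * h" s "h + n"] cop by simp
  define \<sigma> where "\<sigma> = \<phi> ((h + n) * h)"
  have \<sigma>K: "\<sigma> c = c" if "c \<in> K" for c using that by (simp add: \<sigma>_def K_fixed)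
  have \<sigma>_ring: "\<sigma> (x + y) = \<sigma> x + \<sigma> y" "\<sigma> (x - y) = \<sigma> x - \<sigma> y"
    "\<sigma> (x * y) = \<sigma> x * \<sigma> y" for x y
    by (simp_all add: \<sigma>_def frob_ring)
  have "(h + n) * h + ((h + n) * h + (h + n) * h) = 3 * h * (h + n)" by simp
  then have \<sigma>3: "\<sigma> (\<sigma> (\<sigma> x)) = x" for x
    using frob_mult_fixed[OF frob_3h, of "h + n" x] by (simp only: \<sigma>_def frob_frob)
  define s1 where "s1 = \<sigma> s"
  define s2 where "s2 = \<sigma> s1"
  have s0: "\<sigma> s2 = s" by (simp add: s2_def s1_def \<sigma>3)
  have "s1 \<noteq> s"
  proof
    assume "s1 = s"
    then have "\<phi> (h * (h + n)) s = s" by (simp add: s1_def \<sigma>_def mult.commute)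
    moreover have "gcd (h * (h + n)) (3 * h) = h"
      using gcd_mult_distrib_nat[of h "h + n" 3] coprime_imp_gcd_eq_1[OF cop3] by (simp add: mult.commute)
    ultimately show False using s_notin_K K_if_fixed by blast
  qed
  obtain k where k: "h = Suc k" using h_pos by (cases h) auto
  obtain a0 b0 where ab0: "a0 \<in> K" "b0 \<in> K" "P k = a0 * s + b0" using P_linear by blast
  define a where "a = \<epsilon> * \<phi> (h + n) a0 + \<phi> (h + n) b0"
  define b where "b = \<delta> * \<phi> (h + n) a0"
  define a' where "a' = \<epsilon> * \<phi> (h + n) a + \<phi> (h + n) b"
  define b' where "b' = \<delta> * \<phi> (h + n) a"
  have inK: "a \<in> K" "b \<in> K" "a' \<in> K" "b' \<in> K"
    using ab0 \<epsilon>_in_K \<delta>_in_K by (simp_all add: a_def b_def a'_def b'_def)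
  have Ph: "P h = a * s + b" using P_Suc[OF ab0(3)] by (simp add: k a_def b_def)
  have PSh: "P (Suc h) = a' * s + b'" using P_Suc[OF Ph] by (simp add: a'_def b'_def)
  \<comment> \<open>The trace of the matrix of \<open>\<sigma>\<close>.\<close>
  define t where "t = a' + b"
  have "\<phi> (h + n) t = t"
  proof -
    let ?e = "\<phi> ((h + n) * k) \<epsilon>" and ?d = "\<phi> ((h + n) * k) \<delta>"
    have K': "?e * a + ?d * a0 \<in> K" "?e * b + ?d * b0 \<in> K"
      using inK ab0 \<epsilon>_in_K \<delta>_in_K by simp_all
    \<comment> \<open>Both recurrences for \<open>P\<close> express \<open>P (Suc h)\<close>; coefficients over \<open>K\<close> are unique.\<close>
    have "a' * s + b' = (?e * a + ?d * a0) * s + (?e * b + ?d * b0)"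
      using P_Suc_Suc[of k] Ph PSh ab0(3) by (simp add: k algebra_simps)
    then have "a' = ?e * a + ?d * a0"
      by (rule K_linear_unique(1)[OF s_notin_K inK(3,4) K'])
    then have "\<phi> (h + n) a' = \<sigma> \<epsilon> * \<phi> (h + n) a + \<sigma> \<delta> * \<phi> (h + n) a0"
      by (simp add: frob_ring frob_frob \<sigma>_def k)
    then have "\<phi> (h + n) a' = \<epsilon> * \<phi> (h + n) a + b"
      using \<epsilon>_in_K \<delta>_in_K by (simp add: \<sigma>K b_def)
    then show ?thesis by (simp add: t_def frob_ring a'_def)
  qed
  then have t1: "\<phi> 1 t = t" using fixed_1_if_K inK by (simp add: t_def)
  define m0 where "m0 = a * s + b"
  define m1 where "m1 = a * s1 + b"
  define m2 where "m2 = a * s2 + b"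
  have m: "\<sigma> m0 = m1" "\<sigma> m1 = m2"
    using inK by (simp_all add: m0_def m1_def m2_def \<sigma>_ring \<sigma>K s1_def s2_def)
  have r0: "m0 * s1 = a' * s + b'"
    using PSh by (simp add: rel_norm_Suc Ph m0_def s1_def \<sigma>_def)
  have r1: "m1 * s2 = a' * s1 + b'"
    using arg_cong[OF r0, of \<sigma>] inK by (simp add: \<sigma>_ring \<sigma>K m flip: s1_def s2_def)
  have r2: "m2 * s = a' * s2 + b'"
    using arg_cong[OF r1, of \<sigma>] inK by (simp add: \<sigma>_ring \<sigma>K m s0 flip: s2_def)
  have "P (3 * h) = P h * \<sigma> (P h * \<sigma> (P h))"
    using rel_norm_add[of "h + n" h "h + h" s] rel_norm_add[of "h + n" h h s]
    by (simp add: \<sigma>_def numeral_3_eq_3)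
  then have N: "P (3 * h) = m0 * m1 * m2" by (simp add: Ph \<sigma>_ring m flip: m0_def)
  have "m0 \<noteq> 0" using rel_norm_nonzero[OF s_nonzero, of "h + n" h] Ph by (simp add: m0_def)
  \<comment> \<open>Below, \<open>A\<close> and \<open>B\<close> are the two components of the Cayley-Hamilton identity for \<open>M ^ 3\<close>
    applied to the vector \<open>(s, 1)\<close>, in exchanged order.\<close>
  define d where "d = a' * b - a * b'"
  have "m0 * m1 = a * (m0 * s1) + b * m0" by (simp add: m1_def algebra_simps)
  then have m01: "m0 * m1 = t * m0 - d"
    by (simp add: r0) (simp add: m0_def t_def d_def algebra_simps)
  have m12: "m1 * m2 = t * m1 - d"
    using arg_cong[OF m01, of \<sigma>] inK t1 by (simp add: \<sigma>_ring \<sigma>K m t_def d_def)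
  have "m0 * m1 * m2 = t * (m0 * m1) - d * m0"
    by (simp add: mult.assoc m12) (simp add: algebra_simps)
  then have A: "m0 * m1 * m2 = (t * t - d) * m0 - t * d"
    by (simp add: m01) (simp add: algebra_simps)
  have "m0 * m1 * m2 * s = a' * (m0 * (m1 * s2)) + b' * (m0 * m1)"
    by (simp add: mult.assoc r2) (simp add: algebra_simps)
  also have "\<dots> = a' * a' * (m0 * s1) + a' * b' * m0 + b' * (t * m0 - d)"
    by (simp add: r1 m01 algebra_simps)
  also have "\<dots> = (t * t - d) * (m0 * s1) - t * d * s"
    by (simp add: r0) (simp add: m0_def t_def d_def algebra_simps)
  finally have B: "m0 * m1 * m2 * s = (t * t - d) * (m0 * s1) - t * d * s" .
  have "(t * t - d) * m0 * (s1 - s)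
      = ((t * t - d) * (m0 * s1) - t * d * s) - ((t * t - d) * m0 - t * d) * s"
    by (simp add: algebra_simps)
  then have "(t * t - d) * m0 * (s1 - s) = 0" by (simp only: A[symmetric] B[symmetric] diff_self)
  then have "t * t = d" using \<open>m0 \<noteq> 0\<close> \<open>s1 \<noteq> s\<close> by simp
  then have "rel_norm 1 (3 * h) s = (- t) ^ 3"
    using N A by (simp add: power3_eq_cube norm[symmetric] mult.commute[of t d] del: One_nat_def)
  then show ?thesis using t1 frob_minus by metis
qed

end

section \<open>Power residue symbols\<close>

lemma geometric_sum_nat: "(b - 1) * (\<Sum>j<k. b ^ j) = b ^ k - 1" if "b > 1" for b :: nat
  using that power_diff_1_eq[of "int b" k]
  by (simp add: of_nat_diff flip: of_nat_eq_iff[where 'a = int])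

context cubic_extension begin

text \<open>
  Here \<open>x ^ E\<close> is the \<open>(q - 1)\<close>-th power of the norm of \<open>x\<close> onto the field of order \<open>q ^ 3\<close>. So it is
  \<open>1\<close> as soon as this norm lies in the field of order \<open>q\<close>. As \<open>3\<close> divides \<open>h + n\<close> but not \<open>h\<close>, the
  automorphisms \<open>1\<close>, \<open>\<phi> n\<close>, \<open>\<phi> h\<close> restrict to all automorphisms of the field of order \<open>q ^ 3\<close>, so
  that the norm of \<open>x * \<phi> n x * \<phi> h x\<close> down to the field of order \<open>q ^ 3\<close> is itself a norm from there
  to the field of order \<open>q\<close>.
\<close>

lemma residue_exponent_3_dvd:
  assumes "3 dvd h + n"
  defines "E \<equiv> (\<Sum>j<h. q ^ (3 * j)) * (q - 1)"
  shows "u ^ E \<noteq> 1"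
    and "\<And>c. c \<in> K \<Longrightarrow> c \<noteq> 0 \<Longrightarrow> c ^ E = 1"
    and "\<And>x. x \<noteq> 0 \<Longrightarrow> (x * \<phi> n x * \<phi> h x) ^ E = 1"
    and "\<And>s \<epsilon> \<delta>. s \<notin> K \<Longrightarrow> \<epsilon> \<in> K \<Longrightarrow> \<delta> \<in> K \<Longrightarrow> s * \<phi> (h + n) s = \<epsilon> * s + \<delta> \<Longrightarrow> s ^ E = 1"
proof -
  have power_E: "x ^ E = rel_norm 3 h x ^ (q - 1)" for x
    by (simp add: E_def power_mult rel_norm_eq_power)
  have one: "x ^ E = 1" if "\<phi> 1 (rel_norm 3 h x) = rel_norm 3 h x" "x \<noteq> 0" for x
    using power_q_minus_1_eq_1[OF that(1) rel_norm_nonzero[OF that(2)]] by (simp add: power_E)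
  have h3: "\<not> 3 dvd h"
  proof
    assume "3 dvd h"
    then have "3 dvd n" using assms(1) by (simp add: dvd_add_right_iff)
    then have "3 dvd gcd h n" using \<open>3 dvd h\<close> by simp
    then show False using coprime_h_n by (simp add: coprime_imp_gcd_eq_1)
  qed
  have gcd3: "gcd 3 h = 1"
    using h3 prime_imp_coprime[of 3 h] by (simp add: coprime_imp_gcd_eq_1)
  have fixed3: "\<phi> 3 (rel_norm 3 h x) = rel_norm 3 h x" for x by (rule rel_norm_fixed) simp
  show "u ^ E \<noteq> 1"
  proof (rule u_power_neq_1)
    have sum_pos: "(\<Sum>j<h. q ^ (3 * j)) > 0"
      using h_pos q_gt_1 by (intro sum_pos) auto
    then show "0 < E" using q_gt_1 by (simp add: E_def)
    have "q ^ 1 < q ^ 3" by (rule power_strict_increasing) (use q_gt_1 in auto)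
    then have "q - 1 < q ^ 3 - 1" using q_gt_1 by simp
    then have "E < (q ^ 3 - 1) * (\<Sum>j<h. (q ^ 3) ^ j)"
      unfolding E_def mult.commute[of _ "q - 1"] power_mult
      using sum_pos by (intro mult_strict_right_mono) (simp_all add: power_mult)
    also have "\<dots> = q ^ (3 * h) - 1"
      using \<open>q ^ 1 < q ^ 3\<close> q_gt_1 by (subst geometric_sum_nat) (auto simp: power_mult)
    finally show "E < q ^ (3 * h) - 1" .
  qed
  show "c ^ E = 1" if "c \<in> K" "c \<noteq> 0" for c
  proof (rule one)
    have "\<phi> h (rel_norm 3 h c) = rel_norm 3 h c" using that by (simp add: frob_rel_norm K_def)
    then show "\<phi> 1 (rel_norm 3 h c) = rel_norm 3 h c"
      using frob_fixed_gcd[OF fixed3] gcd3 by metis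
  qed fact
  show "(x * \<phi> n x * \<phi> h x) ^ E = 1" if "x \<noteq> 0" for x
  proof (rule one)
    define y where "y = rel_norm 3 h x"
    have y3: "\<phi> 3 y = y" by (simp add: y_def fixed3)
    have mod3: "\<phi> i y = \<phi> (i mod 3) y" for i
      using frob_mult_fixed[OF y3, of "i div 3"] frob_frob[of "i mod 3" "3 * (i div 3)" y] by simp
    have "h mod 3 = 1 \<and> n mod 3 = 2 \<or> h mod 3 = 2 \<and> n mod 3 = 1"
      using h3 assms(1) by presburger
    then have norm: "rel_norm 3 h (x * \<phi> n x * \<phi> h x) = y * \<phi> 1 y * \<phi> 2 y"
      using mod3[of n] mod3[of h] by (auto simp: rel_norm_mult y_def mult_ac simp flip: frob_rel_norm)
    show "\<phi> 1 (rel_norm 3 h (x * \<phi> n x * \<phi> h x)) = rel_norm 3 h (x * \<phi> n x * \<phi> h x)"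
    proof -
      have "\<phi> 1 (\<phi> 1 y) = \<phi> 2 y" "\<phi> 1 (\<phi> 2 y) = y"
        using y3 by (simp_all add: frob_frob numeral_2_eq_2 numeral_3_eq_3)
      then show ?thesis unfolding norm frob_mult by (simp only: mult_ac)
    qed
  qed (use that in simp)
  show "s ^ E = 1" if "s \<notin> K" "\<epsilon> \<in> K" "\<delta> \<in> K" "s * \<phi> (h + n) s = \<epsilon> * s + \<delta>" for s \<epsilon> \<delta>
  proof (rule one)
    interpret moebius_orbit q h n u s \<epsilon> \<delta> by unfold_locales (use that in auto)
    show "\<phi> 1 (rel_norm 3 h s) = rel_norm 3 h s" by (rule norm_fixed) fact
    show "s \<noteq> 0" by (rule s_nonzero)
  qed
qed

text \<open>
  Here \<open>x ^ E\<close> is the \<open>((q - 1) / 3)\<close>-th power of the norm of \<open>x\<close> onto the field of order \<open>q\<close>. So it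
  is \<open>1\<close> as soon as this norm is the cube of an element of that field. The norm of \<open>c \<in> K\<close> is the cube
  of its norm from \<open>K\<close>, and conjugate factors contribute equal norms.
\<close>

lemma residue_exponent_q_cong_1:
  assumes "\<not> 3 dvd h + n" "q mod 3 = 1"
  defines "E \<equiv> (\<Sum>j<3 * h. q ^ j) * ((q - 1) div 3)"
  shows "u ^ E \<noteq> 1"
    and "\<And>c. c \<in> K \<Longrightarrow> c \<noteq> 0 \<Longrightarrow> c ^ E = 1"
    and "\<And>x. x \<noteq> 0 \<Longrightarrow> (x * \<phi> n x * \<phi> h x) ^ E = 1"
    and "\<And>s \<epsilon> \<delta>. s \<notin> K \<Longrightarrow> \<epsilon> \<in> K \<Longrightarrow> \<delta> \<in> K \<Longrightarrow> s * \<phi> (h + n) s = \<epsilon> * s + \<delta> \<Longrightarrow> s ^ E = 1"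
proof -
  have q3: "q - 1 = 3 * ((q - 1) div 3)" using assms(2) q_gt_1 by presburger
  have one: "x ^ E = 1" if "rel_norm 1 (3 * h) x = t ^ 3" "\<phi> 1 t = t" "x \<noteq> 0" for x t
  proof -
    have "t \<noteq> 0" using rel_norm_nonzero[OF that(3), of 1 "3 * h"] that(1) by auto
    have "x ^ E = rel_norm 1 (3 * h) x ^ ((q - 1) div 3)"
      by (simp only: E_def power_mult rel_norm_eq_power mult_1)
    also have "\<dots> = t ^ (q - 1)" by (subst q3) (simp only: that(1) power_mult)
    also have "\<dots> = 1" using power_q_minus_1_eq_1 that(2) \<open>t \<noteq> 0\<close> by blast
    finally show ?thesis .
  qed
  have fixed1: "\<phi> 1 (rel_norm 1 (3 * h) x) = rel_norm 1 (3 * h) x" for x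
    by (rule rel_norm_fixed) simp
  show "u ^ E \<noteq> 1"
  proof (rule u_power_neq_1)
    have "{..<3 * h} \<noteq> {}" using h_pos by (simp only: lessThan_empty_iff)
    then have sum_pos: "(\<Sum>j<3 * h. q ^ j) > 0" using q_gt_1 by (intro sum_pos) auto
    have "(q - 1) div 3 > 0" using q3 q_gt_1 by presburger
    then show "0 < E" using sum_pos by (simp add: E_def)
    moreover have "3 * E = q ^ (3 * h) - 1"
      using q3 geometric_sum_nat[OF q_gt_1, of "3 * h"] unfolding E_def
      by (metis mult.assoc mult.commute)
    ultimately show "E < q ^ (3 * h) - 1" by linarith
  qed
  show "c ^ E = 1" if "c \<in> K" "c \<noteq> 0" for c
  proof (rule one[OF _ _ that(2)])
    have fix_h: "\<phi> h (rel_norm 1 k c) = rel_norm 1 k c" for k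
      using that by (simp add: frob_rel_norm K_def)
    show "rel_norm 1 (3 * h) c = rel_norm 1 h c ^ 3"
      using rel_norm_add[of 1 h "h + h" c] rel_norm_add[of 1 h h c] fix_h
      by (simp add: frob_mult power3_eq_cube numeral_3_eq_3)
    show "\<phi> 1 (rel_norm 1 h c) = rel_norm 1 h c"
      by (rule rel_norm_fixed) (use that in \<open>simp add: K_def\<close>)
  qed
  show "(x * \<phi> n x * \<phi> h x) ^ E = 1" if "x \<noteq> 0" for x
  proof (rule one[OF _ fixed1])
    have "\<phi> i (rel_norm 1 (3 * h) x) = rel_norm 1 (3 * h) x" for i
      using frob_mult_fixed[OF fixed1, of i] by simp
    then show "rel_norm 1 (3 * h) (x * \<phi> n x * \<phi> h x) = rel_norm 1 (3 * h) x ^ 3"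
      by (simp add: rel_norm_mult power3_eq_cube flip: frob_rel_norm)
  qed (use that in simp)
  show "s ^ E = 1" if "s \<notin> K" "\<epsilon> \<in> K" "\<delta> \<in> K" "s * \<phi> (h + n) s = \<epsilon> * s + \<delta>" for s \<epsilon> \<delta>
  proof -
    interpret moebius_orbit q h n u s \<epsilon> \<delta> by unfold_locales (use that in auto)
    obtain t where "\<phi> 1 t = t" "rel_norm 1 (3 * h) s = t ^ 3" using norm_cube[OF assms(1)] by blast
    then show ?thesis using one s_nonzero by blast
  qed
qed

lemma residue_exponent:
  assumes "3 dvd h + n \<or> q mod 3 = 1"
  obtains E where "u ^ E \<noteq> 1"
    and "\<And>c. c \<in> K \<Longrightarrow> c \<noteq> 0 \<Longrightarrow> c ^ E = 1"
    and "\<And>x. x \<noteq> 0 \<Longrightarrow> (x * \<phi> n x * \<phi> h x) ^ E = 1"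
    and "\<And>s \<epsilon> \<delta>. s \<notin> K \<Longrightarrow> \<epsilon> \<in> K \<Longrightarrow> \<delta> \<in> K \<Longrightarrow> s * \<phi> (h + n) s = \<epsilon> * s + \<delta> \<Longrightarrow> s ^ E = 1"
proof (cases "3 dvd h + n")
  case True
  show ?thesis by (rule that[OF residue_exponent_3_dvd[OF True]])
next
  case False
  with assms have q3: "q mod 3 = 1" by simp
  show ?thesis by (rule that[OF residue_exponent_q_cong_1[OF False q3]])
qed

end

section \<open>Absence of zero divisors\<close>

context cubic_extension
begin

text \<open>
  The hypothesis equates two norms from \<open>F\<close> to \<open>K\<close>. Their difference is, up to sign, the determinant
  of the matrix whose rows are the conjugates over \<open>K\<close> of \<open>(z * \<rho> z, \<rho> z - z, 1)\<close> with
  \<open>\<rho> = \<phi> (h + n)\<close>. It vanishes only if the three entries are linearly dependent over \<open>K\<close>.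
\<close>

lemma linear_relation:
  assumes "(z + \<phi> n z) * \<phi> h (z + \<phi> n z) * \<phi> (2 * h) (z + \<phi> n z)
    = (\<phi> h z + \<phi> n z) * \<phi> h (\<phi> h z + \<phi> n z) * \<phi> (2 * h) (\<phi> h z + \<phi> n z)"
  shows "(\<exists>\<beta>\<in>K. \<exists>\<gamma>\<in>K. z * \<phi> (h + n) z + \<beta> * (\<phi> (h + n) z - z) = \<gamma>)
    \<or> \<phi> (h + n) z - z \<in> K"
proof (rule disjCI)
  define z1 where "z1 = \<phi> h z"
  define z2 where "z2 = \<phi> h z1"
  define t0 where "t0 = \<phi> n z"
  define t1 where "t1 = \<phi> h t0"
  define t2 where "t2 = \<phi> h t1"
  have three: "\<phi> h (\<phi> h (\<phi> h x)) = x" for x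
  proof -
    have "h + (h + h) = 3 * h" by simp
    then show ?thesis by (simp only: frob_frob frob_3h)
  qed
  have z: "\<phi> h z2 = z" and t: "\<phi> h t2 = t0"
    by (simp_all only: z2_def z1_def t2_def t1_def three)
  have twice: "\<phi> (2 * h) x = \<phi> h (\<phi> h x)" for x by (simp add: frob_frob mult_2)
  have norms: "(z + t0) * (z1 + t1) * (z2 + t2) = (z1 + t0) * (z2 + t1) * (z + t2)"
    using assms by (simp add: twice frob_add three z flip: z1_def z2_def t0_def t1_def t2_def)
  define A where "A = z * t1"
  define A1 where "A1 = z1 * t2"
  define A2 where "A2 = z2 * t0"
  define B where "B = t1 - z"
  define B1 where "B1 = t2 - z1"
  define B2 where "B2 = t0 - z2"
  have conj: "\<phi> h A = A1" "\<phi> h A1 = A2" "\<phi> h A2 = A" "\<phi> h B = B1" "\<phi> h B1 = B2" "\<phi> h B2 = B"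
    by (simp_all add: A_def A1_def A2_def B_def B1_def B2_def frob_ring z t
        flip: z1_def z2_def t1_def t2_def)
  have rho: "\<phi> (h + n) z = t1" by (simp add: t1_def t0_def frob_frob)
  have det: "(A1 - A) * (B2 - B1) = (A2 - A1) * (B1 - B)"
    using norms unfolding A_def A1_def A2_def B_def B1_def B2_def by (simp add: algebra_simps)
  assume "\<phi> (h + n) z - z \<notin> K"
  then have ne: "B1 \<noteq> B" by (auto simp: rho K_def conj simp flip: B_def)
  then have ne1: "B2 \<noteq> B1" using conj frob_eq_iff by metis
  \<comment> \<open>The choice that makes \<open>A + \<beta> * B\<close> invariant under \<open>\<phi> h\<close>; that \<open>\<beta>\<close> itself is invariant
    is the vanishing of the determinant.\<close>
  define \<beta> where "\<beta> = - (A1 - A) / (B1 - B)"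
  have "\<phi> h \<beta> = - (A2 - A1) / (B2 - B1)" by (simp add: \<beta>_def frob_ring conj)
  also have "\<dots> = \<beta>" using det ne ne1 by (simp add: \<beta>_def field_simps)
  finally have \<beta>: "\<phi> h \<beta> = \<beta>" .
  have "A1 + \<beta> * B1 = A + \<beta> * B" using ne by (simp add: \<beta>_def field_simps)
  then have "\<phi> h (A + \<beta> * B) = A + \<beta> * B" by (simp add: frob_ring \<beta> conj)
  then show "\<exists>\<beta>\<in>K. \<exists>\<gamma>\<in>K. z * \<phi> (h + n) z + \<beta> * (\<phi> (h + n) z - z) = \<gamma>"
    using \<beta> by (auto simp: K_def A_def B_def rho)
qed

end

locale zkw = cubic_extension q h u n for q h n and u :: "'a::{field,finite}" +
  fixes v :: 'a
  assumes odd_q: "odd q" and odd_h: "odd h" and n_pos: "0 < n" and n_less: "n < 3 * h"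
    and v_def: "v = u ^ (q ^ h - 1)"
    and residue_condition: "3 dvd h + n \<or> q mod 3 = 1"
begin

abbreviation mult :: "'a \<Rightarrow> 'a \<Rightarrow> 'a" (infixl "\<star>" 70) where
  "x \<star> y \<equiv> zkw_mult q h n v x y"

lemma mult_frob:
  "x \<star> y = \<phi> n y * x + y * \<phi> n x - v * (\<phi> (h + n) y * \<phi> (2 * h) x + \<phi> (2 * h) y * \<phi> (h + n) x)"
  by (simp add: zkw_mult_def frob_def)

lemma mult_commute: "x \<star> y = y \<star> x"
  by (simp add: mult_frob algebra_simps)

lemma v_u: "v * u = \<phi> h u"
proof -
  have "u ^ (q ^ h - 1) * u = u ^ Suc (q ^ h - 1)" by simp
  then show ?thesis using q_gt_1 by (simp add: v_def frob_def)
qed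

lemma v_nonzero: "v \<noteq> 0" using u_nonzero by (simp add: v_def)

lemma two_neq_0: "(2::'a) \<noteq> 0"
proof
  assume two: "(2::'a) = 0"
  obtain k where "q = 2 * k + 1" using odd_q by (rule oddE)
  then have "1 + 2 * of_nat k = (0::'a)" using of_nat_q by simp
  then show False by (simp add: two)
qed

text \<open>
  The order of \<open>\<phi> n\<close> divides the odd number \<open>3 * h\<close>, so \<open>- 1\<close> is not an eigenvalue of \<open>\<phi> n\<close>.
\<close>

lemma frob_neq_minus:
  assumes "z \<noteq> 0"
  shows "z + \<phi> n z \<noteq> 0"
proof
  assume "z + \<phi> n z = 0"
  then have neg: "\<phi> n z = - z" by (simp add: eq_neg_iff_add_eq_0 add.commute)
  have "\<phi> (n * k) z = (- 1) ^ k * z" for k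
  proof (induction k)
    case (Suc k)
    have "\<phi> (n * Suc k) z = \<phi> (n * k) (\<phi> n z)" by (simp add: frob_frob add.commute)
    then show ?case using Suc by (simp add: neg frob_minus)
  qed simp
  from this[of "3 * h"] have "\<phi> (n * (3 * h)) z = - z" using odd_h by simp
  moreover have "\<phi> (n * (3 * h)) z = z"
    using frob_mult_fixed[OF frob_3h, of n z] by (simp only: mult.commute)
  ultimately have "z + z = 0" by (metis add.right_inverse)
  then have "2 * z = 0" by (simp only: mult_2)
  then show False using assms two_neq_0 by simp
qed

text \<open>
  Multiplying \<open>x \<star> (x * z) = 0\<close> by \<open>u * \<phi> h x\<close> makes both coefficients conjugates of \<open>w\<close>, because
  \<open>v * u = \<phi> h u\<close>.
\<close>

lemma zero_divisor_relation:
  assumes "x \<star> (x * z) = 0"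
  defines "w \<equiv> u * (x * \<phi> n x * \<phi> h x)"
  shows "w * (z + \<phi> n z) = \<phi> h w * \<phi> h (\<phi> h z + \<phi> n z)"
proof -
  have hw: "\<phi> h w = v * u * (\<phi> h x * \<phi> (h + n) x * \<phi> (2 * h) x)"
    by (simp add: w_def frob_mult frob_frob v_u mult_2)
  have "x * \<phi> n x * (z + \<phi> n z) - v * (\<phi> (2 * h) x * \<phi> (h + n) x * \<phi> h (\<phi> h z + \<phi> n z)) = 0"
    using assms(1) by (simp only: mult_frob frob_ring frob_frob mult_2) (simp add: algebra_simps)
  then have "x * \<phi> n x * (z + \<phi> n z) = v * (\<phi> (2 * h) x * \<phi> (h + n) x * \<phi> h (\<phi> h z + \<phi> n z))"
    by simp
  then have "u * \<phi> h x * (x * \<phi> n x * (z + \<phi> n z))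
      = u * \<phi> h x * (v * (\<phi> (2 * h) x * \<phi> (h + n) x * \<phi> h (\<phi> h z + \<phi> n z)))"
    by simp
  then show ?thesis unfolding hw unfolding w_def by (simp only: ac_simps)
qed

text \<open>
  From \<open>z * t + \<beta> * (t - z) = \<gamma>\<close> with \<open>t = \<phi> (h + n) z\<close> one computes, for \<open>s = z + \<beta>\<close>, that the
  quotient of \<open>\<phi> h z + t\<close> by \<open>z + \<phi> h t\<close> is \<open>\<phi> h s / s\<close>; the conjugate of \<open>rel\<close> says that it is also
  \<open>\<phi> h (\<phi> h w) / \<phi> h w\<close>. So \<open>\<phi> h w / s\<close> is fixed by \<open>\<phi> h\<close>. In the degenerate cases \<open>w\<close> itself is in \<open>K\<close>.
\<close>

lemma coset_of_K:
  assumes z: "z \<noteq> 0" and w: "w \<noteq> 0"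
    and rel: "w * (z + \<phi> n z) = \<phi> h w * \<phi> h (\<phi> h z + \<phi> n z)"
  obtains s where "\<phi> h w / s \<in> K" "s \<noteq> 0"
    and "s = 1 \<or> s \<notin> K \<and> (\<exists>\<epsilon>\<in>K. \<exists>\<delta>\<in>K. s * \<phi> (h + n) s = \<epsilon> * s + \<delta>)"
proof -
  have in_K: "\<phi> h w / s \<in> K" if "\<phi> h (\<phi> h w) * s = \<phi> h w * \<phi> h s" "s \<noteq> 0" for s
    using that by (simp add: K_def frob_divide field_simps)
  define P where "P = z + \<phi> n z"
  define R where "R = \<phi> h z + \<phi> n z"
  have P: "P \<noteq> 0" using frob_neq_minus z by (simp add: P_def)
  have three: "\<phi> h (\<phi> h (\<phi> h x)) = x" for x
  proof -
    have "h + (h + h) = 3 * h" by simp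
    then show ?thesis by (simp only: frob_frob frob_3h)
  qed
  have r0: "w * P = \<phi> h w * \<phi> h R" using rel by (simp add: P_def R_def)
  have r1: "\<phi> h w * \<phi> h P = \<phi> h (\<phi> h w) * \<phi> h (\<phi> h R)"
    using arg_cong[OF r0, of "\<phi> h"] by (simp add: frob_mult)
  have r2: "\<phi> h (\<phi> h w) * \<phi> h (\<phi> h P) = w * R"
    using arg_cong[OF r1, of "\<phi> h"] by (simp add: frob_mult three)
  show ?thesis
  proof (cases "z \<in> K")
    case True
    then have "\<phi> h z = z" by (simp add: K_def)
    moreover from this have "\<phi> h R = P" using True by (simp add: P_def R_def frob_add K_def[symmetric] K_fixed)
    ultimately have "\<phi> h w = w" using r0 P by simp
    then show ?thesis using that[of 1] in_K[of 1] by simp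
  next
    case False
    let ?W = "w * \<phi> h w * \<phi> h (\<phi> h w)"
    have "?W * (P * \<phi> h P * \<phi> h (\<phi> h P))
        = (w * P) * (\<phi> h w * \<phi> h P) * (\<phi> h (\<phi> h w) * \<phi> h (\<phi> h P))"
      by (simp only: ac_simps)
    also have "\<dots> = ?W * (R * \<phi> h R * \<phi> h (\<phi> h R))"
      unfolding r0 r1 r2 by (simp only: ac_simps)
    finally have "P * \<phi> h P * \<phi> h (\<phi> h P) = R * \<phi> h R * \<phi> h (\<phi> h R)" using w by simp
    then have "(z + \<phi> n z) * \<phi> h (z + \<phi> n z) * \<phi> (2 * h) (z + \<phi> n z)
      = (\<phi> h z + \<phi> n z) * \<phi> h (\<phi> h z + \<phi> n z) * \<phi> (2 * h) (\<phi> h z + \<phi> n z)"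
      by (simp only: P_def R_def frob_frob mult_2)
    note lin = linear_relation[OF this]
    define t where "t = \<phi> (h + n) z"
    have hP: "\<phi> h P = \<phi> h z + t" by (simp add: P_def t_def frob_add frob_frob)
    have hR: "\<phi> h (\<phi> h R) = z + \<phi> h t"
      by (simp add: R_def t_def frob_add three) (simp add: frob_frob)
    from lin show ?thesis
    proof
      assume "\<phi> (h + n) z - z \<in> K"
      then have "\<phi> h t - \<phi> h z = t - z" by (simp add: K_def t_def frob_diff)
      then have "\<phi> h (\<phi> h R) = \<phi> h P" by (simp add: hP hR algebra_simps)
      then have "\<phi> h (\<phi> h w) = \<phi> h w" using r1 P by simp
      then show ?thesis using that[of 1] in_K[of 1] by simp
    next
      assume "\<exists>\<beta>\<in>K. \<exists>\<gamma>\<in>K. z * \<phi> (h + n) z + \<beta> * (\<phi> (h + n) z - z) = \<gamma>"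
      then obtain \<beta> \<gamma> where \<beta>\<gamma>: "\<beta> \<in> K" "\<gamma> \<in> K" and eq: "z * t + \<beta> * (t - z) = \<gamma>"
        by (auto simp: t_def)
      define s where "s = z + \<beta>"
      have s_notin: "s \<notin> K" using False \<beta>\<gamma>(1) K_closed(4)[of s \<beta>] by (auto simp: s_def)
      then have s: "s \<noteq> 0" by auto
      have \<beta>h: "\<phi> h \<beta> = \<beta>" "\<phi> h \<gamma> = \<gamma>" using \<beta>\<gamma> by (simp_all add: K_def)
      have st: "s * t = \<beta> * z + \<gamma>" using eq by (simp add: s_def algebra_simps)
      have sth: "\<phi> h s * \<phi> h t = \<beta> * \<phi> h z + \<gamma>"
        using arg_cong[OF st, of "\<phi> h"] by (simp add: frob_ring \<beta>h)
      have "s * \<phi> h P = s * t + s * \<phi> h z" by (simp add: hP algebra_simps)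
      also have "\<dots> = \<phi> h s * \<phi> h t + \<phi> h s * z"
        by (simp add: st sth) (simp add: s_def frob_add \<beta>h algebra_simps)
      also have "\<dots> = \<phi> h s * \<phi> h (\<phi> h R)" by (simp add: hR algebra_simps)
      finally have ratio: "s * \<phi> h P = \<phi> h s * \<phi> h (\<phi> h R)" .
      have "(\<phi> h (\<phi> h w) * s) * \<phi> h P = \<phi> h (\<phi> h w) * (\<phi> h s * \<phi> h (\<phi> h R))"
        by (simp only: mult.assoc ratio)
      also have "\<dots> = (\<phi> h w * \<phi> h P) * \<phi> h s" unfolding r1 by (simp only: ac_simps)
      finally have "(\<phi> h (\<phi> h w) * s) * \<phi> h P = (\<phi> h w * \<phi> h s) * \<phi> h P"
        by (simp only: ac_simps)
      then have "\<phi> h (\<phi> h w) * s = \<phi> h w * \<phi> h s" using P by simp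
      then have "\<phi> h w / s \<in> K" using in_K s by blast
      moreover have "s * \<phi> (h + n) s = (\<beta> + \<phi> (h + n) \<beta>) * s + (\<gamma> - \<beta> * \<beta>)"
      proof -
        have "s * \<phi> (h + n) s = s * t + s * \<phi> (h + n) \<beta>"
          by (simp add: s_def frob_add t_def algebra_simps)
        then show ?thesis by (simp add: st) (simp add: s_def algebra_simps)
      qed
      moreover have "\<beta> + \<phi> (h + n) \<beta> \<in> K" "\<gamma> - \<beta> * \<beta> \<in> K" using \<beta>\<gamma> by simp_all
      ultimately show ?thesis using that s s_notin by blast
    qed
  qed
qed

text \<open>
  The residue symbol \<open>w ^ E\<close> is \<open>u ^ E \<noteq> 1\<close> by the shape of \<open>w\<close>, but \<open>1\<close> by \<open>coset_of_K\<close>.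
\<close>

lemma no_zero_divisors:
  assumes "x \<star> y = 0"
  shows "x = 0 \<or> y = 0"
proof (rule ccontr)
  assume "\<not> (x = 0 \<or> y = 0)"
  then have x: "x \<noteq> 0" and y: "y \<noteq> 0" by auto
  define z where "z = y / x"
  have z: "z \<noteq> 0" using x y by (simp add: z_def)
  obtain E where E: "u ^ E \<noteq> 1" "\<And>c. c \<in> K \<Longrightarrow> c \<noteq> 0 \<Longrightarrow> c ^ E = 1"
    "\<And>x. x \<noteq> 0 \<Longrightarrow> (x * \<phi> n x * \<phi> h x) ^ E = 1"
    "\<And>s \<epsilon> \<delta>. s \<notin> K \<Longrightarrow> \<epsilon> \<in> K \<Longrightarrow> \<delta> \<in> K \<Longrightarrow> s * \<phi> (h + n) s = \<epsilon> * s + \<delta> \<Longrightarrow> s ^ E = 1"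
    using residue_exponent[OF residue_condition] by blast
  define w where "w = u * (x * \<phi> n x * \<phi> h x)"
  have w: "w \<noteq> 0" using x u_nonzero by (simp add: w_def)
  have "x \<star> (x * z) = 0" using assms x by (simp add: z_def)
  from zero_divisor_relation[OF this]
  have "w * (z + \<phi> n z) = \<phi> h w * \<phi> h (\<phi> h z + \<phi> n z)" unfolding w_def .
  from coset_of_K[OF z w this] obtain s where s: "\<phi> h w / s \<in> K" "s \<noteq> 0"
    "s = 1 \<or> s \<notin> K \<and> (\<exists>\<epsilon>\<in>K. \<exists>\<delta>\<in>K. s * \<phi> (h + n) s = \<epsilon> * s + \<delta>)" .
  have sE: "s ^ E = 1" using s(3) E(4) by (auto simp: power_one)
  have "(\<phi> h w / s) ^ E = 1" using E(2) s w by simp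
  then have "\<phi> h (w ^ E) = \<phi> h 1" using sE by (simp add: power_divide frob_power)
  then have "w ^ E = 1" by (simp only: frob_eq_iff)
  then show False using E(1) E(3)[OF x] by (simp add: w_def power_mult_distrib)
qed

lemma presemifield: "presemifield (zkw_mult q h n v)"
  unfolding presemifield_def
proof (intro conjI allI impI)
  show "\<exists>a::'a. a \<noteq> 0" using u_nonzero by blast
  show "x \<star> (y + z) = x \<star> y + x \<star> z" "(x + y) \<star> z = x \<star> z + y \<star> z" for x y z
    by (simp_all add: mult_frob frob_add algebra_simps)
qed (rule no_zero_divisors)

section \<open>Adjoint pairs\<close>

lemma coef_mult:
  "coef i (\<lambda>y. x \<star> g y) = x * coef i (\<lambda>y. \<phi> n (g y)) + \<phi> n x * coef i g
    - v * \<phi> (2 * h) x * coef i (\<lambda>y. \<phi> (h + n) (g y))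
    - v * \<phi> (h + n) x * coef i (\<lambda>y. \<phi> (2 * h) (g y))"
proof -
  have "(\<lambda>y. x \<star> g y) = (\<lambda>y. x * \<phi> n (g y) + \<phi> n x * g y
      + - (v * \<phi> (2 * h) x) * \<phi> (h + n) (g y) + - (v * \<phi> (h + n) x) * \<phi> (2 * h) (g y))"
    by (rule ext) (simp add: mult_frob algebra_simps)
  then show ?thesis by (simp only: coef_add coef_scale) simp
qed

lemma coef_mult_id:
  "coef i (\<lambda>y. x \<star> y) = x * (if [i = n] (mod 3 * h) then 1 else 0)
    + \<phi> n x * (if [i = 0] (mod 3 * h) then 1 else 0)
    - v * \<phi> (2 * h) x * (if [i = h + n] (mod 3 * h) then 1 else 0)
    - v * \<phi> (h + n) x * (if [i = 2 * h] (mod 3 * h) then 1 else 0)"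
  by (subst coef_mult) (simp only: coef_frob coef_id)

text \<open>
  The coefficients of \<open>\<phi> i y\<close> on both sides of \<open>f x \<star> y = x \<star> g y\<close>. On the right the dependence on
  \<open>x\<close> is explicit, so for suitable \<open>i\<close> this displays \<open>f\<close> as a combination of four Frobenius powers.
\<close>

lemma adjoint_coef:
  assumes "\<And>x y. f x \<star> y = x \<star> g y"
  shows "f x * (if [i = n] (mod 3 * h) then 1 else 0)
    + \<phi> n (f x) * (if [i = 0] (mod 3 * h) then 1 else 0)
    - v * \<phi> (2 * h) (f x) * (if [i = h + n] (mod 3 * h) then 1 else 0)
    - v * \<phi> (h + n) (f x) * (if [i = 2 * h] (mod 3 * h) then 1 else 0)
    = x * coef i (\<lambda>y. \<phi> n (g y)) + \<phi> n x * coef i g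
    - v * \<phi> (2 * h) x * coef i (\<lambda>y. \<phi> (h + n) (g y))
    - v * \<phi> (h + n) x * coef i (\<lambda>y. \<phi> (2 * h) (g y))"
  unfolding coef_mult_id[of i "f x", symmetric] coef_mult[of i x g, symmetric] assms ..

lemma cong_cases:
  assumes "[a = b] (mod 3 * h)" "a < 9 * h" "b < 9 * h"
  shows "a = b \<or> a = b + 3 * h \<or> a = b + 6 * h \<or> b = a + 3 * h \<or> b = a + 6 * h"
proof -
  have "\<exists>k. a = b + 3 * h * k \<or> b = a + 3 * h * k"
    using assms(1) by (metis cong_def mod_eq_nat1E mod_eq_nat2E nat_le_linear)
  then obtain k where k: "a = b + 3 * h * k \<or> b = a + 3 * h * k" by blast
  have "k < 3"
  proof (rule ccontr)
    assume "\<not> k < 3"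
    then have "3 * h * k \<ge> 3 * h * 3" by (intro mult_le_mono2) simp
    then show False using k assms(2,3) by linarith
  qed
  then have "k = 0 \<or> k = 1 \<or> k = 2" by auto
  then show ?thesis using k by auto
qed

lemma two_n_neq_h: "2 * n \<noteq> h"
  using odd_h by auto

text \<open>
  The coefficients at \<open>n\<close> and at \<open>0\<close> show that both \<open>f x\<close> and \<open>\<phi> n (f x)\<close> are combinations of
  \<open>\<phi> i x\<close> with \<open>i\<close> in \<open>{0, n, 2 * h, h + n}\<close>. Among the exponents shifted by \<open>n\<close> only \<open>0 + n\<close> lies
  in this set again, so only the coefficient of \<open>\<phi> 0\<close> in \<open>f\<close> survives.
\<close>

lemma adjoint_scalar:
  assumes fg: "\<And>x y. f x \<star> y = x \<star> g y" and n: "n \<noteq> h" "n \<noteq> 2 * h"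
  shows "\<exists>a. \<forall>x. f x = a * x"
proof -
  have nc: "\<not> [n = 0] (mod 3 * h)" "\<not> [n = h + n] (mod 3 * h)" "\<not> [n = 2 * h] (mod 3 * h)"
    "\<not> [0 = n] (mod 3 * h)" "\<not> [0 = h + n] (mod 3 * h)" "\<not> [0 = 2 * h] (mod 3 * h)"
    using n n_pos n_less h_pos by (auto dest!: cong_cases)
  obtain \<alpha> \<beta> \<gamma> \<kappa> where f: "f x = \<alpha> * \<phi> 0 x + \<beta> * \<phi> n x + \<gamma> * \<phi> (2 * h) x + \<kappa> * \<phi> (h + n) x" for x
  proof
    show "f x = coef n (\<lambda>y. \<phi> n (g y)) * \<phi> 0 x + coef n g * \<phi> n x
        + (- v * coef n (\<lambda>y. \<phi> (h + n) (g y))) * \<phi> (2 * h) x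
        + (- v * coef n (\<lambda>y. \<phi> (2 * h) (g y))) * \<phi> (h + n) x" for x
      using adjoint_coef[OF fg, of x n] by (simp add: nc)
  qed
  obtain \<alpha>' \<beta>' \<gamma>' \<kappa>' where f':
    "\<phi> n (f x) = \<alpha>' * \<phi> 0 x + \<beta>' * \<phi> n x + \<gamma>' * \<phi> (2 * h) x + \<kappa>' * \<phi> (h + n) x" for x
  proof
    show "\<phi> n (f x) = coef 0 (\<lambda>y. \<phi> n (g y)) * \<phi> 0 x + coef 0 g * \<phi> n x
        + (- v * coef 0 (\<lambda>y. \<phi> (h + n) (g y))) * \<phi> (2 * h) x
        + (- v * coef 0 (\<lambda>y. \<phi> (2 * h) (g y))) * \<phi> (h + n) x" for x
      using adjoint_coef[OF fg, of x 0] by (simp add: nc)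
  qed
  have "\<phi> n (f x) = \<phi> n \<alpha> * \<phi> n x + \<phi> n \<beta> * \<phi> (2 * n) x
      + \<phi> n \<gamma> * \<phi> (2 * h + n) x + \<phi> n \<kappa> * \<phi> (h + 2 * n) x" for x
    unfolding f by (simp only: frob_ring frob_frob mult_2 add_0_right) (simp only: ac_simps)
  then have eq: "(\<lambda>x. \<phi> n \<alpha> * \<phi> n x + \<phi> n \<beta> * \<phi> (2 * n) x
      + \<phi> n \<gamma> * \<phi> (2 * h + n) x + \<phi> n \<kappa> * \<phi> (h + 2 * n) x)
    = (\<lambda>x. \<alpha>' * \<phi> 0 x + \<beta>' * \<phi> n x + \<gamma>' * \<phi> (2 * h) x + \<kappa>' * \<phi> (h + n) x)"
    using f' by auto
  note coef_eq = arg_cong[OF eq, of "coef i" for i, unfolded coef_frobs]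
  \<comment> \<open>The three shifted exponents differ from each other and from \<open>0\<close>, \<open>n\<close>, \<open>2 * h\<close>, \<open>h + n\<close> modulo
    \<open>3 * h\<close>. Parity enters through \<open>2 * n \<noteq> 3 * h\<close> and \<open>2 * n \<noteq> h\<close>.\<close>
  have nc2: "\<not> [2 * n = 0] (mod 3 * h)" "\<not> [2 * n = n] (mod 3 * h)"
      "\<not> [2 * n = 2 * h] (mod 3 * h)" "\<not> [2 * n = h + n] (mod 3 * h)"
      "\<not> [2 * n = 2 * h + n] (mod 3 * h)" "\<not> [2 * n = h + 2 * n] (mod 3 * h)"
    using n n_pos n_less h_pos odd_h by (auto dest!: cong_cases) presburger+
  have nc3: "\<not> [2 * h + n = 0] (mod 3 * h)" "\<not> [2 * h + n = n] (mod 3 * h)"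
      "\<not> [2 * h + n = 2 * h] (mod 3 * h)" "\<not> [2 * h + n = h + n] (mod 3 * h)"
      "\<not> [2 * h + n = 2 * n] (mod 3 * h)" "\<not> [2 * h + n = h + 2 * n] (mod 3 * h)"
    using n n_pos n_less h_pos odd_h by (auto dest!: cong_cases)
  have nc4: "\<not> [h + 2 * n = 0] (mod 3 * h)" "\<not> [h + 2 * n = n] (mod 3 * h)"
      "\<not> [h + 2 * n = 2 * h] (mod 3 * h)" "\<not> [h + 2 * n = h + n] (mod 3 * h)"
      "\<not> [h + 2 * n = 2 * n] (mod 3 * h)" "\<not> [h + 2 * n = 2 * h + n] (mod 3 * h)"
    using n n_pos n_less h_pos odd_h two_n_neq_h by (auto dest!: cong_cases) presburger+
  have "\<beta> = 0" using coef_eq[of "2 * n"] by (simp add: nc2)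
  moreover have "\<gamma> = 0" using coef_eq[of "2 * h + n"] by (simp add: nc3)
  moreover have "\<kappa> = 0" using coef_eq[of "h + 2 * n"] by (simp add: nc4)
  ultimately show ?thesis using f by auto
qed

text \<open>
  For \<open>f = (*) a\<close> and \<open>g = (*) b\<close>, comparing coefficients gives \<open>a = \<phi> n b\<close>, \<open>b = \<phi> n a\<close> and
  \<open>\<phi> (h + n) a = \<phi> (2 * h) b\<close>. The order of \<open>\<phi> n\<close> is odd, so \<open>\<phi> n a = a\<close>; then also \<open>\<phi> h a = a\<close>,
  and \<open>h\<close> and \<open>n\<close> are coprime.
\<close>

lemma adjoint_generic:
  assumes fg: "\<And>x y. f x \<star> y = x \<star> g y" and n: "n \<noteq> h" "n \<noteq> 2 * h"
  shows "\<exists>c. \<phi> 1 c = c \<and> (\<forall>x. f x = c * x \<and> g x = c * x)"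
proof -
  have nc: "\<not> [n = 0] (mod 3 * h)" "\<not> [n = h + n] (mod 3 * h)" "\<not> [n = 2 * h] (mod 3 * h)"
    "\<not> [0 = n] (mod 3 * h)" "\<not> [0 = h + n] (mod 3 * h)" "\<not> [0 = 2 * h] (mod 3 * h)"
    "\<not> [2 * h = n] (mod 3 * h)" "\<not> [2 * h = h + n] (mod 3 * h)" "\<not> [2 * h = 0] (mod 3 * h)"
    using n n_pos n_less h_pos by (auto dest!: cong_cases)
  obtain a where a: "\<And>x. f x = a * x" using adjoint_scalar[OF fg n] by blast
  have "g x \<star> y = x \<star> f y" for x y using fg[of y x] by (simp only: mult_commute)
  then obtain b where b: "\<And>x. g x = b * x" using adjoint_scalar n by metis
  have ab: "a = \<phi> n b" "\<phi> n a = b" "\<phi> (h + n) a = \<phi> (2 * h) b"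
    using adjoint_coef[OF fg, of 1 n] adjoint_coef[OF fg, of 1 0] adjoint_coef[OF fg, of 1 "2 * h"] v_nonzero
    by (simp_all add: a b frob_mult coef_id coef_scale coef_frob nc)
  have "\<phi> (2 * n) a = a" using ab by (simp add: mult_2 flip: frob_frob)
  moreover have "gcd (2 * n) (3 * h) dvd n"
  proof -
    have "odd (gcd (2 * n) (3 * h))" using odd_h by (metis dvd_trans gcd_dvd2 even_mult_iff odd_numeral)
    then show ?thesis
      by (metis coprime_dvd_mult_right_iff gcd_dvd1 coprime_right_2_iff_odd)
  qed
  ultimately have an: "\<phi> n a = a" using frob_fixed_dvd frob_3h by blast
  have "\<phi> h (\<phi> n a) = \<phi> h (\<phi> h b)" using ab(3) by (simp only: frob_frob mult_2)
  then have "\<phi> h a = a" using ab(2) an by simp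
  then have "\<phi> 1 a = a"
    using frob_fixed_gcd[OF _ an, of h] coprime_h_n by (simp add: coprime_imp_gcd_eq_1)
  then show ?thesis using a b ab(2) an by auto
qed

text \<open>
  As \<open>h + n = 3\<close> is the full degree, the product is a multiple of Albert's commutative twisted field
  product \<open>x * \<phi> 2 y + \<phi> 2 x * y\<close>.
\<close>

lemma adjoint_twisted_field:
  assumes fg: "\<And>x y. f x \<star> y = x \<star> g y" and h: "h = 1" and n: "n = 2"
  shows "\<exists>c. \<phi> 1 c = c \<and> (\<forall>x. f x = c * x \<and> g x = c * x)"
proof -
  have three: "\<phi> 3 x = x" for x using frob_3h[of x] by (simp add: h)
  have m: "x \<star> y = (1 - v) * (x * \<phi> 2 y + \<phi> 2 x * y)" for x y
  proof -
    have indices: "h + n = 3" "2 * h = 2" by (simp_all add: h n)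
    show ?thesis
      by (subst mult_frob) (simp only: indices three, simp add: n algebra_simps)
  qed
  have "v \<noteq> 1" using no_zero_divisors[of 1 1] by (auto simp: m)
  then have fg': "f x * \<phi> 2 y + \<phi> 2 (f x) * y = x * \<phi> 2 (g y) + \<phi> 2 x * g y" for x y
    using fg[of x y] by (simp add: m)
  have coef: "f x * (if [i = 2] (mod 3) then 1 else 0) + \<phi> 2 (f x) * (if [i = 0] (mod 3) then 1 else 0)
      = x * coef i (\<lambda>y. \<phi> 2 (g y)) + \<phi> 2 x * coef i g"
    if "\<And>x y. f x * \<phi> 2 y + \<phi> 2 (f x) * y = x * \<phi> 2 (g y) + \<phi> 2 x * g y" for f g i x
  proof -
    have "coef i (\<lambda>y. f x * \<phi> 2 y + \<phi> 2 (f x) * y) = coef i (\<lambda>y. x * \<phi> 2 (g y) + \<phi> 2 x * g y)"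
      by (simp only: that)
    then show ?thesis by (simp add: coef_add coef_scale coef_id coef_frob h)
  qed
  have scalar: "\<exists>a. \<forall>x. f x = a * x"
    if fg: "\<And>x y. f x * \<phi> 2 y + \<phi> 2 (f x) * y = x * \<phi> 2 (g y) + \<phi> 2 x * g y" for f g
  proof -
    define \<alpha> where "\<alpha> = coef 2 (\<lambda>y. \<phi> 2 (g y))"
    define \<beta> where "\<beta> = coef 2 g"
    have f: "f x = \<alpha> * x + \<beta> * \<phi> 2 x" for x
      using coef[OF fg, of x 2] by (simp add: \<alpha>_def \<beta>_def cong_def mult.commute)
    define \<alpha>' where "\<alpha>' = coef 0 (\<lambda>y. \<phi> 2 (g y))"
    define \<beta>' where "\<beta>' = coef 0 g"
    have f': "\<phi> 2 (f x) = \<alpha>' * x + \<beta>' * \<phi> 2 x" for x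
      using coef[OF fg, of x 0] by (simp add: \<alpha>'_def \<beta>'_def cong_def mult.commute)
    have "(\<lambda>x. \<phi> 2 \<alpha> * \<phi> 2 x + \<phi> 2 \<beta> * \<phi> 4 x) = (\<lambda>x. \<alpha>' * x + \<beta>' * \<phi> 2 x)"
      using f' by (simp add: f frob_ring frob_frob)
    from arg_cong[OF this, of "coef 1"] have "\<phi> 2 \<beta> = 0"
      by (simp add: coef_add coef_scale coef_frob coef_id h cong_def)
    then show ?thesis using f by auto
  qed
  obtain a where a: "\<And>x. f x = a * x" using scalar[OF fg'] by blast
  have gf': "g x * \<phi> 2 y + \<phi> 2 (g x) * y = x * \<phi> 2 (f y) + \<phi> 2 x * f y" for x y
    using fg'[of y x] by (simp add: algebra_simps)
  then obtain b where b: "\<And>x. g x = b * x" using scalar[OF gf'] by blast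
  have ab: "a = \<phi> 2 b" "\<phi> 2 a = b"
    using coef[OF fg', of 1 2] coef[OF fg', of 1 0]
    by (simp_all add: a b frob_mult coef_scale coef_id coef_frob h cong_def)
  have "\<phi> 4 a = \<phi> 2 (\<phi> 2 a)" by (simp add: frob_frob)
  then have "\<phi> 4 a = a" "b = \<phi> 2 a" by (simp_all only: ab(2) ab(1)[symmetric])
  moreover have "\<phi> 4 a = \<phi> 1 a" using three[of a] frob_frob[of 1 3 a] by simp
  ultimately show ?thesis using a b frob_mult_fixed[of 1 a 2] by auto
qed

text \<open>
  The norm of \<open>v\<close> is \<open>1\<close>, so taking norms in \<open>c = - 2 * v * \<phi> i c\<close> with \<open>c \<noteq> 0\<close> gives \<open>1 = - 8\<close>. Then
  the characteristic is \<open>3\<close>, contrary to \<open>q \<equiv> 1\<close> modulo \<open>3\<close>.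
\<close>

lemma norm_obstruction:
  assumes h: "h = 1" and q: "q mod 3 = 1" and c: "c = - 2 * v * \<phi> i c"
  shows "c = 0"
proof (rule ccontr)
  assume "c \<noteq> 0"
  have fixed: "\<phi> 1 (rel_norm 1 3 x) = rel_norm 1 3 x" for x
    by (rule rel_norm_fixed) (use frob_3h[of x] in \<open>simp add: h\<close>)
  have invariant: "rel_norm 1 3 (\<phi> j x) = rel_norm 1 3 x" for j x
    using frob_mult_fixed[OF fixed, of j] by (simp flip: frob_rel_norm)
  have "rel_norm 1 3 (v * u) = rel_norm 1 3 u" by (simp only: v_u invariant)
  then have "rel_norm 1 3 v = 1" using rel_norm_nonzero[OF u_nonzero, of 1 3] by (simp add: rel_norm_mult)
  moreover have "\<phi> j 2 = 2" for j using frob_add[of j 1 1] by simp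
  then have "rel_norm 1 3 (- 2) = - 8" by (simp add: rel_norm_def frob_minus numeral_3_eq_3)
  moreover have "rel_norm 1 3 c = rel_norm 1 3 (- 2) * rel_norm 1 3 v * rel_norm 1 3 c"
    using arg_cong[OF c, of "rel_norm 1 3"] by (simp only: rel_norm_mult invariant)
  ultimately have "1 = (- 8 :: 'a)" using rel_norm_nonzero[OF \<open>c \<noteq> 0\<close>, of 1 3] by simp
  then have "(3 * 3 :: 'a) = 0" by (simp add: eq_neg_iff_add_eq_0)
  then have "(3 :: 'a) = 0" by (simp only: mult_eq_0_iff) simp
  moreover have "q = 3 * (q div 3) + 1" using q by presburger
  then have "of_nat q = (3 * of_nat (q div 3) + 1 :: 'a)"
    by (metis of_nat_1 of_nat_add of_nat_mult of_nat_numeral)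
  ultimately show False using of_nat_q by simp
qed

text \<open>
  Here \<open>h + n\<close> and \<open>2 * h\<close> coincide and \<open>x \<star> y = x * \<phi> 1 y + \<phi> 1 x * y - 2 * v * \<phi> 2 x * \<phi> 2 y\<close> involves
  every exponent modulo \<open>3\<close>, so comparing exponents does not remove the coefficients of \<open>\<phi> 1\<close> and
  \<open>\<phi> 2\<close> in \<open>f\<close>. They satisfy
  \<open>c = - 2 * v * \<phi> i c\<close>, up to a conjugation, and vanish by
  \<open>norm_obstruction\<close>.
\<close>

lemma adjoint_prime_degree:
  assumes fg: "\<And>x y. f x \<star> y = x \<star> g y" and h: "h = 1" and n: "n = 1"
  shows "\<exists>c. \<phi> 1 c = c \<and> (\<forall>x. f x = c * x \<and> g x = c * x)"
proof -
  have q: "q mod 3 = 1" using residue_condition unfolding h n by presburger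
  have three: "\<phi> 3 x = x" for x using frob_3h[of x] by (simp add: h)
  have four: "\<phi> 4 x = \<phi> 1 x" for x using three[of x] frob_frob[of 1 3 x] by simp
  have coef': "f x * (if [i = 1] (mod 3) then 1 else 0) + \<phi> 1 (f x) * (if [i = 0] (mod 3) then 1 else 0)
      - 2 * v * \<phi> 2 (f x) * (if [i = 2] (mod 3) then 1 else 0)
    = x * coef i (\<lambda>y. \<phi> 1 (g y)) + \<phi> 1 x * coef i g - 2 * v * \<phi> 2 x * coef i (\<lambda>y. \<phi> 2 (g y))"
    if "\<And>x y. f x \<star> y = x \<star> g y" for f g i x
    using adjoint_coef[OF that, of x i] by (simp add: h n numeral_2_eq_2 algebra_simps split: if_splits)
  have span: "\<exists>a0 a1 a2. \<forall>x. f x = a0 * x + a1 * \<phi> 1 x + a2 * \<phi> 2 x"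
    if "\<And>x y. f x \<star> y = x \<star> g y" for f g
  proof (intro exI allI)
    fix x
    show "f x = coef 1 (\<lambda>y. \<phi> 1 (g y)) * x + coef 1 g * \<phi> 1 x
        + (- 2 * v * coef 1 (\<lambda>y. \<phi> 2 (g y))) * \<phi> 2 x"
      using coef'[OF that, of x 1] by (simp add: cong_def algebra_simps)
  qed
  obtain a0 a1 a2 where f: "\<And>x. f x = a0 * x + a1 * \<phi> 1 x + a2 * \<phi> 2 x"
    using span[OF fg] by blast
  have gf: "g x \<star> y = x \<star> f y" for x y using fg[of y x] by (simp only: mult_commute)
  obtain b0 b1 b2 where g: "\<And>x. g x = b0 * x + b1 * \<phi> 1 x + b2 * \<phi> 2 x"
    using span[OF gf] by blast
  have co: "coef i (\<lambda>x. c0 * x + c1 * \<phi> 1 x + c2 * \<phi> 2 x)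
      = (if [i = 0] (mod 3) then c0 else 0) + (if [i = 1] (mod 3) then c1 else 0)
      + (if [i = 2] (mod 3) then c2 else 0)" for i c0 c1 c2
    using coef_frobs[of i c0 0 c1 1 c2 2 0 0] by (simp add: h)
  have g1: "\<phi> 1 (g y) = \<phi> 1 b2 * y + \<phi> 1 b0 * \<phi> 1 y + \<phi> 1 b1 * \<phi> 2 y" for y
    using three by (simp add: g frob_ring frob_frob numeral_2_eq_2 numeral_3_eq_3)
  have g2: "\<phi> 2 (g y) = \<phi> 2 b1 * y + \<phi> 2 b2 * \<phi> 1 y + \<phi> 2 b0 * \<phi> 2 y" for y
    using three four by (simp add: g frob_ring frob_frob)
  have f1: "\<phi> 1 (f y) = \<phi> 1 a2 * y + \<phi> 1 a0 * \<phi> 1 y + \<phi> 1 a1 * \<phi> 2 y" for y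
    using three by (simp add: f frob_ring frob_frob numeral_2_eq_2 numeral_3_eq_3)
  have "f x = \<phi> 1 b0 * x + b1 * \<phi> 1 x + (- 2 * v * \<phi> 2 b2) * \<phi> 2 x" for x
    using coef'[OF fg, of x 1] unfolding g1 g2 unfolding g co by (simp add: cong_def algebra_simps)
  then have eq1: "(\<lambda>x. a0 * x + a1 * \<phi> 1 x + a2 * \<phi> 2 x)
      = (\<lambda>x. \<phi> 1 b0 * x + b1 * \<phi> 1 x + (- 2 * v * \<phi> 2 b2) * \<phi> 2 x)" by (simp only: f)
  have "\<phi> 1 (f x) = \<phi> 1 b2 * x + b0 * \<phi> 1 x + (- 2 * v * \<phi> 2 b1) * \<phi> 2 x" for x
    using coef'[OF fg, of x 0] unfolding g1 g2 unfolding g co by (simp add: cong_def algebra_simps)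
  then have eq0: "(\<lambda>x. \<phi> 1 a2 * x + \<phi> 1 a0 * \<phi> 1 x + \<phi> 1 a1 * \<phi> 2 x)
      = (\<lambda>x. \<phi> 1 b2 * x + b0 * \<phi> 1 x + (- 2 * v * \<phi> 2 b1) * \<phi> 2 x)" by (simp only: f1)
  have c1: "a0 = \<phi> 1 b0" "a1 = b1" "a2 = - 2 * v * \<phi> 2 b2"
    using arg_cong[OF eq1, of "coef 0"] arg_cong[OF eq1, of "coef 1"] arg_cong[OF eq1, of "coef 2"]
    unfolding co by (simp_all add: cong_def)
  have c0: "a2 = b2" "\<phi> 1 a0 = b0" "\<phi> 1 a1 = - 2 * v * \<phi> 2 b1"
    using arg_cong[OF eq0, of "coef 0"] arg_cong[OF eq0, of "coef 1"] arg_cong[OF eq0, of "coef 2"]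
    unfolding co by (simp_all add: cong_def)
  have "a2 = 0" using c1(3) c0(1) by (intro norm_obstruction[OF h q, of _ 2]) simp
  have "\<phi> 1 (\<phi> 1 a1) = \<phi> 2 b1" by (simp add: frob_frob c1(2) numeral_2_eq_2)
  then have "\<phi> 1 a1 = - 2 * v * \<phi> 1 (\<phi> 1 a1)" using c0(3) by (simp only:)
  then have "\<phi> 1 a1 = 0" by (rule norm_obstruction[OF h q])
  then have "a1 = 0" by simp
  have "\<phi> 1 (\<phi> 1 a0) = a0" using c0(2) c1(1) by simp
  then have "\<phi> 2 a0 = a0" by (simp add: frob_frob numeral_2_eq_2)
  then have "\<phi> 1 a0 = a0" using three[of a0] frob_frob[of 1 2 a0] by (simp add: numeral_3_eq_3)
  then show ?thesis using f g \<open>a1 = 0\<close> \<open>a2 = 0\<close> c0 c1 by auto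
qed

lemma adjoint_imp_subfield_scalar:
  assumes "\<And>x y. f x \<star> y = x \<star> g y"
  shows "\<exists>c. \<phi> 1 c = c \<and> f = (*) c \<and> g = (*) c"
proof -
  have "\<exists>c. \<phi> 1 c = c \<and> (\<forall>x. f x = c * x \<and> g x = c * x)"
  proof (cases "n = h \<or> n = 2 * h")
    case True
    then have "h = 1" using coprime_h_n by auto
    then show ?thesis using True adjoint_twisted_field[OF assms] adjoint_prime_degree[OF assms] by auto
  next
    case False
    then show ?thesis using adjoint_generic[OF assms] by blast
  qed
  then show ?thesis by (metis ext)
qed

lemma subfield_scalar_mult:
  assumes "\<phi> 1 c = c"
  shows "(c * x) \<star> y = c * (x \<star> y)" "x \<star> (c * y) = c * (x \<star> y)"
proof -
  have "\<phi> i c = c" for i using frob_mult_fixed[OF assms, of i] by simp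
  then show "(c * x) \<star> y = c * (x \<star> y)" "x \<star> (c * y) = c * (x \<star> y)"
    by (simp_all add: mult_frob frob_mult algebra_simps)
qed

lemma card_adjoint_pairs: "card (adjoint_pairs (zkw_mult q h n v)) = q"
proof -
  have "adjoint_pairs (zkw_mult q h n v) = (\<lambda>c. ((*) c, (*) c)) ` {c. \<phi> 1 c = c}"
  proof (intro equalityI subsetI)
    fix p assume p: "p \<in> adjoint_pairs (zkw_mult q h n v)"
    obtain f g where p_def: "p = (f, g)" by (cases p)
    then have "f x \<star> y = x \<star> g y" for x y using p by (simp add: adjoint_pairs_def)
    then show "p \<in> (\<lambda>c. ((*) c, (*) c)) ` {c. \<phi> 1 c = c}"
      using adjoint_imp_subfield_scalar[of f g] by (auto simp: p_def)
  qed (auto simp: adjoint_pairs_def subfield_scalar_mult)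
  moreover have "inj (\<lambda>c::'a. ((*) c, (*) c))"
    by (rule injI) (metis mult.right_neutral prod.inject)
  ultimately show ?thesis by (simp add: card_image inj_on_subset card_subfield[simplified])
qed

lemma card_scalar_triples: "card (scalar_triples (zkw_mult q h n v)) = q"
proof -
  have "scalar_triples (zkw_mult q h n v) = (\<lambda>c. ((*) c, (*) c, (*) c)) ` {c. \<phi> 1 c = c}"
  proof (intro equalityI subsetI)
    fix p assume p: "p \<in> scalar_triples (zkw_mult q h n v)"
    obtain f g k where p_def: "p = (f, g, k)" by (cases p)
    have k: "f x \<star> y = k (x \<star> y)" "x \<star> g y = k (x \<star> y)" for x y
      using p by (simp_all add: p_def scalar_triples_def)
    then obtain c where c: "\<phi> 1 c = c" "f = (*) c" "g = (*) c"
      using adjoint_imp_subfield_scalar[of f g] by auto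
    \<comment> \<open>Every element is a product, so \<open>k\<close> is determined by \<open>f\<close>.\<close>
    have "bij (\<lambda>y. 1 \<star> y)" using presemifield unfolding presemifield_iff_bij by simp
    then have "\<exists>y. z = 1 \<star> y" for z using bij_is_surj by (metis surjD)
    then have "k z = c * z" for z using k(1) subfield_scalar_mult(1)[OF c(1)] c(2) by metis
    then show "p \<in> (\<lambda>c. ((*) c, (*) c, (*) c)) ` {c. \<phi> 1 c = c}" using c by (auto simp: p_def)
  qed (auto simp: scalar_triples_def subfield_scalar_mult)
  moreover have "inj (\<lambda>c::'a. ((*) c, (*) c, (*) c))"
    by (rule injI) (metis mult.right_neutral prod.inject)
  ultimately show ?thesis by (simp add: card_image inj_on_subset card_subfield[simplified])
qed

end

theorem theorem4p8:
  fixes q h n :: nat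
    and u v :: "'a::{field,finite}"
  assumes "primepow q" and "odd q"
    and "odd h"
    and "CARD('a) = q ^ (3 * h)"
    and "0 < n" and "n < 3 * h" and "gcd h n = 1"
    and "primitive_element u" and "v = u ^ (q ^ h - 1)"
    and "[h + n = 0] (mod 3) \<or> [q = 1] (mod 3)"
  shows "presemifield (zkw_mult q h n v) \<and>
    (\<exists>S :: 'a \<Rightarrow> 'a \<Rightarrow> 'a. semifield S \<and> isotopic (zkw_mult q h n v) S) \<and>
    (\<forall>S :: 'b::{ab_group_add,finite} \<Rightarrow> 'b \<Rightarrow> 'b.
       semifield S \<and> isotopic (zkw_mult q h n v) S \<longrightarrow>
         card (middle_nucleus S) = q \<and> card (semifield_center S) = q)"
proof -
  have "3 dvd h + n \<or> q mod 3 = 1"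
    using assms(10) by (auto simp: cong_def dvd_eq_mod_eq_0)
  moreover have "coprime h n" using assms(7) by (simp only: coprime_iff_gcd_eq_1)
  ultimately interpret zkw q h n u v
    using assms(1-6,8,9) by unfold_locales
  show ?thesis
  proof (intro conjI allI impI)
    show "presemifield (zkw_mult q h n v)" by (rule presemifield)
    then show "\<exists>S :: 'a \<Rightarrow> 'a \<Rightarrow> 'a. semifield S \<and> isotopic (zkw_mult q h n v) S"
      by (rule presemifield_isotopic_semifield)
    fix S :: "'b \<Rightarrow> 'b \<Rightarrow> 'b"
    assume S: "semifield S \<and> isotopic (zkw_mult q h n v) S"
    show "card (middle_nucleus S) = q"
      using S semifield_card_middle_nucleus[of S] isotopic_card_adjoint_pairs[of _ S]
        card_adjoint_pairs by metis
    show "card (semifield_center S) = q"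
      using S semifield_card_center[of S] isotopic_card_scalar_triples[of _ S]
        card_scalar_triples by metis
  qed
qed

end
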